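(* Let $\{Z_n\}_{n\ge 0}$ be a branching process in an i.i.d. random environment, with $X=\ln m_0$, $\mu=\mathbb{E}X$, $\sigma^2=\mathbb{E}(X-\mu)^2$ as in the context, such that almost surely every individual has at least one child and $0<\sigma^2<\infty$. Assume that there exist real constants $H_1<H_2$ such that $H_1\le X-\mu\le H_2$ almost surely. Then for all integers $n_0\ge0$, $n\ge1$ and all $x\in[0,2(H_2-H_1))$, $$\mathbb{P}\left(\frac1n\ln\frac{Z_{n_0+n}}{Z_{n_0}}-\mu\ge x\right)\le\exp\Big\{-n\max\big(\psi_1(x),\psi_2(x)\big)\Big\}+\exp\left\{-\tfrac12nx\right\}$$ $$\le\left(1-\frac{x}{2(H_2-H_1)}\right)^{\frac{nx}{H_2-H_1}\left(1-\frac{x}{4(H_2-H_1)}\right)}+\exp\left\{-\tfrac12nx\right\},$$ where $$\psi_1(x)=\frac{x^2}{2(H_2-H_1)^2}+\frac{x^4}{36(H_2-H_1)^4}$$ and $$\psi_2(x)=\left(\frac{x^2}{4(H_2-H_1)^2}-\frac{x}{H_2-H_1}\right)\ln\left(1-\frac{x}{2(H_2-H_1)}\right),\qquad x\in[0,2(H_2-H_1)).$$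
   Context: Branching process in a random environment: $\xi=(\xi_0,\xi_1,\dots)$ is a sequence of i.i.d. random variables (the environment). Each value of $\xi_n$ determines a probability distribution $p(\xi_n)=\{p_n(i): i\in\mathbb{N}\}$ on $\mathbb{N}=\{0,1,2,\dots\}$ (the offspring law at generation $n$). The process is defined by $Z_0=1$ and $Z_{n+1}=\sum_{i=1}^{Z_n}N_{n,i}$ for $n\ge 0$, where, conditionally on $\xi$, the variables $\{N_{n,i}: n\ge0,i\ge1\}$ are independent and, for each $n$, the $N_{n,i}$ $(i\ge1)$ have common law $p(\xi_n)$. $\mathbb{P}$ is the total (annealed) law, i.e. $\mathbb{P}(dx,d\xi)=\mathbb{P}_\xi(dx)\tau(d\xi)$ with $\mathbb{P}_\xi$ the conditional law given $\xi$ and $\tau$ the law of $\xi$; $\mathbb{E}$ is the corresponding expectation. Put $m_n=\sum_{i\ge0} i\,p_n(i)$ (conditional mean offspring number at generation $n$ given $\xi$), $X=\ln m_0$, $\mu=\mathbb{E}X$, $\sigma^2=\mathbb{E}(X-\mu)^2$, $\sigma>0$. Standing assumption: $p_0(0)=0$ almost surely (the probability of having no children is zero) and $0<\sigma^2<\infty$; hence $Z_n\ge1$ a.s. for all $n$. *)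

theory Defs
  imports "HOL-Probability.Probability"
begin

definition cond_prob_of :: "'w measure \<Rightarrow> 'w measure \<Rightarrow> 'w set \<Rightarrow> 'w \<Rightarrow> real" where
  "cond_prob_of M F A = real_cond_exp M F (indicator A)"

definition cond_indep_vars ::
  "'w measure \<Rightarrow> 'w measure \<Rightarrow> ('i \<Rightarrow> 'a measure) \<Rightarrow> ('i \<Rightarrow> 'w \<Rightarrow> 'a) \<Rightarrow> 'i set \<Rightarrow> bool" where
  "cond_indep_vars M F M' Y I \<longleftrightarrow>
     (\<forall>i\<in>I. Y i \<in> measurable M (M' i)) \<and>
     (\<forall>J B. J \<subseteq> I \<longrightarrow> finite J \<longrightarrow> (\<forall>j\<in>J. B j \<in> sets (M' j)) \<longrightarrow>
        (AE \<omega> in M. cond_prob_of M F {\<omega>\<in>space M. \<forall>j\<in>J. Y j \<omega> \<in> B j} \<omega> =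
           (\<Prod>j\<in>J. cond_prob_of M F {\<omega>\<in>space M. Y j \<omega> \<in> B j} \<omega>)))"

text \<open>The \<open>\<sigma>\<close>-algebra generated by the whole environment \<open>\<xi> = (\<xi>\<^sub>0, \<xi>\<^sub>1, \<dots>)\<close>.\<close>

definition env_algebra :: "'w measure \<Rightarrow> 's measure \<Rightarrow> (nat \<Rightarrow> 'w \<Rightarrow> 's) \<Rightarrow> 'w measure" where
  "env_algebra M S \<xi> =
     vimage_algebra (space M) (\<lambda>\<omega> n. \<xi> n \<omega>) (\<Pi>\<^sub>M n\<in>(UNIV :: nat set). S)"

text \<open>\<open>S\<close> is the state space of one environment coordinate and \<open>p s\<close> the offspring law
  determined by the environment value \<open>s\<close>. The variables \<open>N n i\<close> are used only for \<open>i \<ge> 1\<close>.\<close>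

locale branching_random_env = prob_space M
  for M :: "'w measure"
    and S :: "'s measure"
    and p :: "'s \<Rightarrow> nat pmf"
    and \<xi> :: "nat \<Rightarrow> 'w \<Rightarrow> 's"
    and N :: "nat \<Rightarrow> nat \<Rightarrow> 'w \<Rightarrow> nat" +
  assumes law_measurable: "\<And>k. (\<lambda>s. pmf (p s) k) \<in> borel_measurable S"
    and env_indep: "indep_vars (\<lambda>_. S) \<xi> UNIV"
    and env_identically_distributed: "\<And>n. distr M S (\<xi> n) = distr M S (\<xi> 0)"
    and offspring_cond_indep:
      "cond_indep_vars M (env_algebra M S \<xi>) (\<lambda>_. count_space UNIV)
         (\<lambda>(n, i). N n i) (UNIV \<times> {1..})"
    and offspring_cond_law:
      "\<And>n i B. i \<ge> 1 \<Longrightarrow>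
         AE \<omega> in M. cond_prob_of M (env_algebra M S \<xi>) {\<omega>\<in>space M. N n i \<omega> \<in> B} \<omega> =
           measure_pmf.prob (p (\<xi> n \<omega>)) B"

primrec population :: "(nat \<Rightarrow> nat \<Rightarrow> 'w \<Rightarrow> nat) \<Rightarrow> nat \<Rightarrow> 'w \<Rightarrow> nat" where
  "population N 0 \<omega> = 1"
| "population N (Suc n) \<omega> = (\<Sum>i = 1..population N n \<omega>. N n i \<omega>)"

text \<open>A Bochner integral, hence \<open>0\<close> if the offspring law has infinite mean; statements using it
  should ask for \<open>finite_offspring_mean\<close>.\<close>

definition offspring_mean ::
  "('s \<Rightarrow> nat pmf) \<Rightarrow> (nat \<Rightarrow> 'w \<Rightarrow> 's) \<Rightarrow> nat \<Rightarrow> 'w \<Rightarrow> real" where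
  "offspring_mean p \<xi> n \<omega> = measure_pmf.expectation (p (\<xi> n \<omega>)) real"

definition finite_offspring_mean ::
  "('s \<Rightarrow> nat pmf) \<Rightarrow> (nat \<Rightarrow> 'w \<Rightarrow> 's) \<Rightarrow> nat \<Rightarrow> 'w \<Rightarrow> bool" where
  "finite_offspring_mean p \<xi> n \<omega> \<longleftrightarrow> integrable (measure_pmf (p (\<xi> n \<omega>))) real"

definition log_mean :: "('s \<Rightarrow> nat pmf) \<Rightarrow> (nat \<Rightarrow> 'w \<Rightarrow> 's) \<Rightarrow> 'w \<Rightarrow> real" where
  "log_mean p \<xi> \<omega> = ln (offspring_mean p \<xi> 0 \<omega>)"

definition drift :: "'w measure \<Rightarrow> ('s \<Rightarrow> nat pmf) \<Rightarrow> (nat \<Rightarrow> 'w \<Rightarrow> 's) \<Rightarrow> real" where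
  "drift M p \<xi> = (\<integral>\<omega>. log_mean p \<xi> \<omega> \<partial>M)"

definition env_variance :: "'w measure \<Rightarrow> ('s \<Rightarrow> nat pmf) \<Rightarrow> (nat \<Rightarrow> 'w \<Rightarrow> 's) \<Rightarrow> real" where
  "env_variance M p \<xi> = (\<integral>\<omega>. (log_mean p \<xi> \<omega> - drift M p \<xi>)\<^sup>2 \<partial>M)"

definition psi1 :: "real \<Rightarrow> real \<Rightarrow> real \<Rightarrow> real" where
  "psi1 H\<^sub>1 H\<^sub>2 x = x^2 / (2 * (H\<^sub>2 - H\<^sub>1)^2) + x^4 / (36 * (H\<^sub>2 - H\<^sub>1)^4)"

definition psi2 :: "real \<Rightarrow> real \<Rightarrow> real \<Rightarrow> real" where
  "psi2 H\<^sub>1 H\<^sub>2 x =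
     (x^2 / (4 * (H\<^sub>2 - H\<^sub>1)^2) - x / (H\<^sub>2 - H\<^sub>1)) * ln (1 - x / (2 * (H\<^sub>2 - H\<^sub>1)))"

end

theory Submission
  imports Defs
begin

text \<open>Write \<open>ln (Z\<^bsub>n\<^sub>0+n\<^esub> / Z\<^bsub>n\<^sub>0\<^esub>) = \<Sum> ln m\<^sub>i + ln W\<close> with
  \<open>W = Z\<^bsub>n\<^sub>0+n\<^esub> / (Z\<^bsub>n\<^sub>0\<^esub> \<Prod> m\<^sub>i)\<close>. Conditioning on the environment and the earlier generations
  gives \<open>E W \<le> 1\<close>, so by Markov's inequality \<open>ln W \<ge> n x / 2\<close> has probability at most
  \<open>exp (- n x / 2)\<close>. The other half of the deviation must come from the i.i.d. bounded variables
  \<open>ln m\<^sub>i - \<mu>\<close>. By convexity their Chernoff bound is that of a centred two-point law with weight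
  \<open>p\<close> at the upper end; with \<open>v = x / (2 (H\<^sub>2 - H\<^sub>1))\<close> one has
  \<open>\<psi>\<^sub>1 = 2 v\<^sup>2 + 4 v\<^sup>4 / 9\<close>, a lower bound for the relative entropy of Bernoulli laws with
  parameters \<open>p + v\<close> and \<open>p\<close>, and \<open>\<psi>\<^sub>2 = (v\<^sup>2 - 2 v) ln (1 - v)\<close>, which is below \<open>\<psi>\<^sub>1\<close> for
  \<open>v \<le> 1/2\<close> and otherwise is reached with the Chernoff parameter \<open>1 / (1 - v)\<close>, whatever \<open>p\<close> is.\<close>

section \<open>The exponent of centred two-point laws\<close>

text \<open>The fraction is the [2/2] Pade approximant of \<open>ln\<close> at 1. The derivative of
  the difference collapses to \<open>(y - 1) ^ 4 / (y * (y\<^sup>2 + 4 * y + 1)\<^sup>2)\<close>,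
  which is nonnegative.\<close>

lemma ln_ge_pade:
  fixes x :: real
  assumes "1 \<le> x"
  shows "3 * (x\<^sup>2 - 1) / (x\<^sup>2 + 4 * x + 1) \<le> ln x"
proof -
  let ?f = "\<lambda>x::real. ln x - 3 * (x\<^sup>2 - 1) / (x\<^sup>2 + 4 * x + 1)"
  have "?f 1 \<le> ?f x"
  proof (rule DERIV_nonneg_imp_nondecreasing[OF assms])
    fix y :: real
    assume y: "1 \<le> y" "y \<le> x"
    have pos: "y\<^sup>2 + 4 * y + 1 > 0" using y by (simp add: add_pos_nonneg)
    let ?D = "1 / y - (6 * y * (y\<^sup>2 + 4 * y + 1) - 3 * (y\<^sup>2 - 1) * (2 * y + 4)) / (y\<^sup>2 + 4 * y + 1)\<^sup>2"
    have "(?f has_real_derivative ?D) (at y)"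
      using y pos by (auto intro!: derivative_eq_intros simp: power2_eq_square)
    moreover have "?D = (y - 1) ^ 4 / (y * (y\<^sup>2 + 4 * y + 1)\<^sup>2)"
      using y pos by (simp add: divide_simps) (simp add: algebra_simps eval_nat_numeral)
    ultimately show "\<exists>D. (?f has_real_derivative D) (at y) \<and> 0 \<le> D"
      using y by (intro exI[of _ ?D]) simp
  qed
  then show ?thesis by simp
qed

lemma exp_lower_Taylor_cubic:
  fixes x :: real
  assumes "0 \<le> x"
  shows "1 + x + x\<^sup>2 / 2 + x ^ 3 / 6 \<le> exp x"
proof -
  let ?f = "\<lambda>x::real. exp x - (1 + x + x\<^sup>2 / 2 + x ^ 3 / 6)"
  have "?f 0 \<le> ?f x"
  proof (rule DERIV_nonneg_imp_nondecreasing[OF assms])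
    fix y :: real
    assume "0 \<le> y" "y \<le> x"
    then have "0 \<le> exp y - (1 + y + y\<^sup>2 / 2)"
      using exp_lower_Taylor_quadratic[of y] by simp
    moreover have "(?f has_real_derivative exp y - (1 + y + y\<^sup>2 / 2)) (at y)"
      by (auto intro!: derivative_eq_intros)
    ultimately show "\<exists>D. (?f has_real_derivative D) (at y) \<and> 0 \<le> D" by blast
  qed
  then show ?thesis by simp
qed

lemma exp_2_ge: "7.38 \<le> exp (2::real)"
proof -
  have "2.7182 \<le> exp (1::real)"
    using e_approx_32 by (simp add: abs_if split: if_splits)
  then have "2.7182 * 2.7182 \<le> exp 1 * exp (1::real)" by (intro mult_mono) auto
  also have "\<dots> = exp (2::real)" by (simp flip: exp_add)
  finally show ?thesis by simp
qed

lemma ln_one_minus_le_quadratic: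
  fixes y :: real
  assumes "0 \<le> y" "y < 1"
  shows "ln (1 - y) \<le> - y - y\<^sup>2 / 2"
proof -
  let ?f = "\<lambda>y::real. - y - y\<^sup>2 / 2 - ln (1 - y)"
  have "?f 0 \<le> ?f y"
  proof (rule DERIV_nonneg_imp_nondecreasing[OF assms(1)])
    fix z :: real
    assume z: "0 \<le> z" "z \<le> y"
    then have "0 \<le> - 1 - z + 1 / (1 - z)" using assms by (simp add: field_simps)
    moreover have "(?f has_real_derivative - 1 - z + 1 / (1 - z)) (at z)"
      using z assms by (auto intro!: derivative_eq_intros)
    ultimately show "\<exists>D. (?f has_real_derivative D) (at z) \<and> 0 \<le> D" by blast
  qed
  then show ?thesis by simp
qed

text \<open>This is what remains of the Chernoff estimate for \<open>v \<ge> 1/2\<close> once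
  \<open>p\<close> is eliminated and \<open>s = 1 / (1 - v)\<close>. Replacing
  \<open>ln (1 - exp (- s))\<close> by a quadratic, \<open>ln s\<close> by its Pade bound and
  \<open>exp s\<close> by a Taylor polynomial around 2 leaves a polynomial inequality in
  \<open>d = s - 2\<close>.\<close>

lemma exponent_bound_ge_2:
  fixes s :: real
  assumes "2 \<le> s"
  shows "s / (exp s - 1) + ln (1 - exp (- s)) \<le> ln s / s\<^sup>2"
proof -
  define d where "d = s - 2"
  have d: "0 \<le> d" and s: "s = 2 + d" using assms by (auto simp: d_def)
  define a where "a = exp s"
  have "7.38 * (1 + d + d\<^sup>2 / 2 + d ^ 3 / 6) \<le> exp 2 * exp d"
    using d by (intro mult_mono exp_2_ge exp_lower_Taylor_cubic) auto
  then have a_ge: "7.38 * (1 + d + d\<^sup>2 / 2 + d ^ 3 / 6) \<le> a"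
    by (simp add: a_def s exp_add)
  have "7.38 * 1 \<le> 7.38 * (1 + d + d\<^sup>2 / 2 + d ^ 3 / 6)"
    using d by (intro mult_left_mono) auto
  then have a: "7.38 \<le> a" using a_ge by linarith
  have e: "exp (- s) = 1 / a" by (simp add: a_def exp_minus field_simps)
  have "s / (a - 1) + ln (1 - 1 / a) \<le> s / (a - 1) - 1 / a - (1 / a)\<^sup>2 / 2"
    using ln_one_minus_le_quadratic[of "1 / a"] a by simp
  also have "\<dots> = (s - 1 + (1 + 1 / a) * (1 / a) / 2) / (a - 1)"
    using a by (simp add: field_simps power2_eq_square)
  \<comment> \<open>As \<open>a \<ge> 7.38\<close>, the correction term is at most 1.136 * 0.136 / 2
    < 0.08. The constant 0.92 below is 1 - 0.08.\<close>
  also have "\<dots> \<le> (s - 1 + 0.08) / (a - 1)"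
  proof -
    have ia: "1 / a \<le> 0.136" using a by (simp add: field_simps)
    have "(1 + 1 / a) * (1 / a) / 2 \<le> (1 + 0.136) * 0.136 / 2"
      using ia a by (intro divide_right_mono mult_mono add_left_mono) auto
    also have "\<dots> \<le> 0.08" by simp
    finally show ?thesis using a by (intro divide_right_mono add_left_mono) auto
  qed
  also have "\<dots> \<le> (3 * (s\<^sup>2 - 1) / (s\<^sup>2 + 4 * s + 1)) / s\<^sup>2"
  proof -
    have "s\<^sup>2 * (s - 0.92) * (s\<^sup>2 + 4 * s + 1)
        \<le> 3 * (s\<^sup>2 - 1) * (7.38 * (1 + d + d\<^sup>2 / 2 + d ^ 3 / 6) - 1)"
    proof -
      \<comment> \<open>The slack is small at \<open>s = 2\<close>, where it is 1.26, but expanded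
        in \<open>d\<close> every coefficient is positive. The factor 7.38 and the cubic term in the
        bound for \<open>exp s\<close> are chosen sharp enough for this.\<close>
      have "3 * (s\<^sup>2 - 1) * (7.38 * (1 + d + d\<^sup>2 / 2 + d ^ 3 / 6) - 1)
            - s\<^sup>2 * (s - 0.92) * (s\<^sup>2 + 4 * s + 1)
          = 1.26 + 0.26 * d + 3.99 * d\<^sup>2 + 15.53 * d ^ 3 + 12.75 * d ^ 4 + 2.69 * d ^ 5"
        unfolding s by (simp add: field_simps eval_nat_numeral)
      moreover have "0 \<le> 1.26 + 0.26 * d + 3.99 * d\<^sup>2 + 15.53 * d ^ 3 + 12.75 * d ^ 4 + 2.69 * d ^ 5"
        using d by (intro add_nonneg_nonneg mult_nonneg_nonneg) auto
      ultimately show ?thesis by linarith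
    qed
    also have "\<dots> \<le> 3 * (s\<^sup>2 - 1) * (a - 1)"
      using a_ge assms by (intro mult_left_mono) (auto simp: power2_eq_square intro: mult_mono[of 1 s 1 s, simplified])
    finally have "s\<^sup>2 * (s - 0.92) * (s\<^sup>2 + 4 * s + 1) \<le> 3 * (s\<^sup>2 - 1) * (a - 1)" .
    then show ?thesis using a assms
      by (simp add: field_simps add_pos_pos)
  qed
  also have "\<dots> \<le> ln s / s\<^sup>2"
    using ln_ge_pade[of s] assms by (intro divide_right_mono) auto
  finally show ?thesis unfolding e by (simp add: a_def)
qed

text \<open>In the scaled variable this says that the second exponent does not exceed the first on
  \<open>[0, 1/2]\<close>. Dividing by \<open>v * (2 - v)\<close> isolates the logarithm; the
  derivative then has the sign of \<open>15 - 32 * y + 8 * y\<^sup>2\<close>, which still equals 1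
  at \<open>y = 1/2\<close>.\<close>

lemma log_exponent_le_quartic:
  fixes v :: real
  assumes "0 \<le> v" "v \<le> 1 / 2"
  shows "(v\<^sup>2 - 2 * v) * ln (1 - v) \<le> 2 * v\<^sup>2 + 4 / 9 * v ^ 4"
proof -
  let ?f = "\<lambda>v::real. (2 * v + 4 / 9 * v ^ 3) / (2 - v) + ln (1 - v)"
  have "?f 0 \<le> ?f v"
  proof (rule DERIV_nonneg_imp_nondecreasing[OF assms(1)])
    fix y :: real
    assume "0 \<le> y" "y \<le> v"
    then have y: "0 \<le> y" "y \<le> 1 / 2" using assms by auto
    let ?D = "((2 + 4 / 3 * y\<^sup>2) * (2 - y) + (2 * y + 4 / 9 * y ^ 3)) / (2 - y)\<^sup>2 - 1 / (1 - y)"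
    have "(?f has_real_derivative ?D) (at y)"
      using y by (auto intro!: derivative_eq_intros simp: power2_eq_square)
    moreover have "?D = y\<^sup>2 * (15 - 32 * y + 8 * y\<^sup>2) / (9 * (2 - y)\<^sup>2 * (1 - y))"
      using y by (simp add: divide_simps) (simp add: algebra_simps eval_nat_numeral)
    moreover have "0 \<le> 15 - 32 * y + 8 * y\<^sup>2"
    proof -
      have "15 - 32 * y + 8 * y\<^sup>2 = 8 * (1 / 2 - y)\<^sup>2 + 24 * (1 / 2 - y) + 1"
        by (simp add: power2_eq_square algebra_simps)
      also have "0 \<le> \<dots>" using y by (intro add_nonneg_nonneg) auto
      finally show ?thesis .
    qed
    ultimately show "\<exists>D. (?f has_real_derivative D) (at y) \<and> 0 \<le> D"
      using y by (intro exI[of _ ?D]) simp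
  qed
  then have "0 \<le> (v * (2 - v)) * ?f v" using assms by (intro mult_nonneg_nonneg) auto
  also have "\<dots> = 2 * v\<^sup>2 + 4 / 9 * v ^ 4 - (v\<^sup>2 - 2 * v) * ln (1 - v)"
    using assms by (simp add: divide_simps) (simp add: algebra_simps eval_nat_numeral)
  finally show ?thesis by simp
qed

text \<open>Integrating \<open>1 / (q (1 - q)) \<ge> 4 + 16 (q - 1/2)\<^sup>2\<close> twice in \<open>q\<close> from \<open>p\<close> gives a quartic
  that exceeds the claimed bound by \<open>8 v\<^sup>2 (v / 3 - (1/2 - p))\<^sup>2\<close>.\<close>

lemma Bernoulli_relative_entropy_ge:
  fixes p v :: real
  assumes p: "0 < p" and v: "0 \<le> v" "p + v < 1"
  shows "2 * v\<^sup>2 + 4 / 9 * v ^ 4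
    \<le> (p + v) * ln ((p + v) / p) + (1 - p - v) * ln ((1 - p - v) / (1 - p))"
proof -
  define c where "c = 1 / 2 - p"
  have p1: "p < 1" using v by simp
  let ?F' = "\<lambda>v. ln (p + v) - ln p - ln (1 - p - v) + ln (1 - p)
    - (4 * v + 16 * (v ^ 3 / 3 - c * v\<^sup>2 + c\<^sup>2 * v))"
  let ?F = "\<lambda>v. (p + v) * (ln (p + v) - ln p) + (1 - p - v) * (ln (1 - p - v) - ln (1 - p))
    - (2 * v\<^sup>2 + 16 * (v ^ 4 / 12 - c * v ^ 3 / 3 + c\<^sup>2 * v\<^sup>2 / 2))"
  have F': "0 \<le> ?F' w" if w: "0 \<le> w" "w \<le> v" for w
  proof -
    have "?F' 0 \<le> ?F' w"
    proof (rule DERIV_nonneg_imp_nondecreasing[OF w(1)])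
      fix y
      assume "0 \<le> y" "y \<le> w"
      then have y: "0 < p + y" "0 < 1 - p - y" using w v p by auto
      let ?D = "1 / (p + y) + 1 / (1 - p - y) - (4 + 16 * (y\<^sup>2 - 2 * c * y + c\<^sup>2))"
      have "(?F' has_real_derivative ?D) (at y)"
        by (rule derivative_eq_intros refl | use y in simp)+
      moreover have "0 \<le> ?D"
      proof -
        \<comment> \<open>Centring the Bernoulli parameter at 1/2 turns the claim into \<open>(4 +
          16 * z\<^sup>2) * (1/4 - z\<^sup>2) = 1 - 16 * z ^ 4 \<le> 1\<close>.\<close>
        define z where "z = y - c"
        have eqs: "p + y = 1 / 2 + z" "1 - p - y = 1 / 2 - z" "y\<^sup>2 - 2 * c * y + c\<^sup>2 = z\<^sup>2"
          by (auto simp: z_def c_def power2_eq_square algebra_simps)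
        have z: "0 < (1 / 2 + z) * (1 / 2 - z)" using y unfolding eqs by simp
        have "(4 + 16 * z\<^sup>2) * ((1 / 2 + z) * (1 / 2 - z)) = 1 - 16 * z ^ 4"
          by (simp add: field_simps eval_nat_numeral)
        then have "4 + 16 * z\<^sup>2 \<le> 1 / ((1 / 2 + z) * (1 / 2 - z))"
          using z by (simp add: le_divide_eq)
        also have "\<dots> = 1 / (1 / 2 + z) + 1 / (1 / 2 - z)"
          using y unfolding eqs by (simp add: divide_simps)
        finally show ?thesis unfolding eqs by simp
      qed
      ultimately show "\<exists>D. (?F' has_real_derivative D) (at y) \<and> 0 \<le> D"
        by blast
    qed
    then show ?thesis by simp
  qed
  have "?F 0 \<le> ?F v"
  proof (rule DERIV_nonneg_imp_nondecreasing[OF v(1)])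
    fix y
    assume y: "0 \<le> y" "y \<le> v"
    then have "0 < p + y" "0 < 1 - p - y" using v p by auto
    then have "(?F has_real_derivative ?F' y) (at y)"
      by - (rule derivative_eq_intros refl | simp)+
    with F'[OF y] show "\<exists>D. (?F has_real_derivative D) (at y) \<and> 0 \<le> D" by blast
  qed
  then have "0 \<le> ?F v" by simp
  moreover have "2 * v\<^sup>2 + 16 * (v ^ 4 / 12 - c * v ^ 3 / 3 + c\<^sup>2 * v\<^sup>2 / 2)
      = 2 * v\<^sup>2 + 4 / 9 * v ^ 4 + 8 * v\<^sup>2 * (v / 3 - c)\<^sup>2"
    by (simp add: power2_eq_square power3_eq_cube power4_eq_xxxx algebra_simps)
  moreover have "0 \<le> 8 * v\<^sup>2 * (v / 3 - c)\<^sup>2" by simp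
  moreover have "ln ((p + v) / p) = ln (p + v) - ln p"
    "ln ((1 - p - v) / (1 - p)) = ln (1 - p - v) - ln (1 - p)"
    using p v by (simp_all add: ln_div)
  ultimately show ?thesis by (simp only:)
qed

text \<open>The Chernoff expression of the centred Bernoulli variable at \<open>v\<close> is that of
  the uncentred one at \<open>p + v\<close>: the factor \<open>exp (- s * p)\<close> moves out of
  the bracket.\<close>

lemma Bernoulli_mgf_eq:
  fixes p s v :: real
  shows "exp (- s * v) * ((1 - p) * exp (- s * p) + p * exp (s * (1 - p)))
    = exp (- s * (p + v)) * (1 - p + p * exp s)"
proof -
  have "exp (s * (1 - p)) = exp (- s * p) * exp s"
    by (simp add: right_diff_distrib flip: exp_add)
  moreover have "exp (- s * (p + v)) = exp (- s * v) * exp (- s * p)"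
    by (simp add: distrib_left flip: exp_add)
  ultimately show ?thesis by (simp only:) (simp only: algebra_simps)
qed

text \<open>At the optimal parameter the Chernoff expression equals the exponential of minus the
  relative entropy, for which the quartic lower bound is available.\<close>

lemma Bernoulli_Chernoff_quartic:
  fixes p v :: real
  assumes p: "0 < p" and v: "0 \<le> v" "p + v < 1"
  obtains s where "0 \<le> s"
    "exp (- s * v) * ((1 - p) * exp (- s * p) + p * exp (s * (1 - p)))
      \<le> exp (- (2 * v\<^sup>2 + 4 / 9 * v ^ 4))"
proof -
  \<comment> \<open>The minimiser: under exponential tilting by this \<open>s\<close> the Bernoulli
    variable has mean \<open>p + v\<close>, that is
    \<open>p * exp s / (1 - p + p * exp s) = p + v\<close>.\<close>
  define s where "s = ln ((p + v) * (1 - p) / (p * (1 - p - v)))"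
  have es: "exp s = (p + v) * (1 - p) / (p * (1 - p - v))"
    unfolding s_def using p v by simp
  have "(p + v) * (1 - p) = p * (1 - p - v) + v" by (simp add: algebra_simps)
  then have "1 \<le> exp s" unfolding es using p v by (simp add: le_divide_eq)
  then have s0: "0 \<le> s" by simp
  have "p * exp s = (p + v) * (1 - p) / (1 - p - v)"
    unfolding es using p by simp
  then have "(1 - p) + p * exp s = ((1 - p) * (1 - p - v) + (p + v) * (1 - p)) / (1 - p - v)"
    using v by (simp add: add_divide_distrib)
  also have "(1 - p) * (1 - p - v) + (p + v) * (1 - p) = 1 - p" by (simp add: algebra_simps)
  finally have "(1 - p) + p * exp s = (1 - p) / (1 - p - v)" .
  then have "exp (- s * v) * ((1 - p) * exp (- s * p) + p * exp (s * (1 - p)))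
      = exp (- s * (p + v)) * ((1 - p) / (1 - p - v))"
    by (simp only: Bernoulli_mgf_eq)
  also have "(1 - p) / (1 - p - v) = exp (ln ((1 - p) / (1 - p - v)))" using p v by simp
  also have "ln ((1 - p) / (1 - p - v)) = ln (1 - p) - ln (1 - p - v)"
    using p v by (simp add: ln_div)
  also have "exp (- s * (p + v)) * exp \<dots>
      = exp (- ((p + v) * ln ((p + v) / p) + (1 - p - v) * ln ((1 - p - v) / (1 - p))))"
  proof -
    have "s = ln (p + v) + ln (1 - p) - ln p - ln (1 - p - v)"
      unfolding s_def using p v by (simp add: ln_div ln_mult)
    moreover have "ln ((p + v) / p) = ln (p + v) - ln p"
      "ln ((1 - p - v) / (1 - p)) = ln (1 - p - v) - ln (1 - p)"
      using p v by (simp_all add: ln_div)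
    ultimately show ?thesis
      unfolding exp_add[symmetric] by (simp only:) (simp add: algebra_simps)
  qed
  also have "\<dots> \<le> exp (- (2 * v\<^sup>2 + 4 / 9 * v ^ 4))"
    using Bernoulli_relative_entropy_ge[OF assms] by simp
  finally show ?thesis using that s0 by blast
qed

text \<open>The parameter \<open>s = 1 / (1 - v)\<close> is optimal to leading order as \<open>v \<rightarrow> 1\<close>; the dependence on
  \<open>p\<close> disappears by the tangent to the logarithm at \<open>(exp s - 1) / s\<close>.\<close>

lemma Bernoulli_Chernoff_log:
  fixes p v :: real
  assumes p: "0 \<le> p" and v: "1 / 2 \<le> v" "v < 1"
  obtains s where "0 \<le> s"
    "exp (- s * v) * ((1 - p) * exp (- s * p) + p * exp (s * (1 - p)))
      \<le> exp (- ((v\<^sup>2 - 2 * v) * ln (1 - v)))"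
proof -
  define s where "s = 1 / (1 - v)"
  have s: "2 \<le> s" unfolding s_def using v by (simp add: field_simps)
  have v_eq: "v = 1 - 1 / s" unfolding s_def using v by simp
  define e where "e = exp s - 1"
  have e: "0 < e" unfolding e_def using s by simp
  have pos: "0 < 1 + p * e" using p e by (simp add: add_pos_nonneg)
  have "ln (1 + p * e) = ln ((1 + p * e) * s / e) + ln (e / s)"
    using pos e s by (simp add: ln_mult ln_div)
  also have "ln ((1 + p * e) * s / e) \<le> (1 + p * e) * s / e - 1"
    using pos e s by (intro ln_le_minus_one) simp
  finally have "ln (1 + p * e) \<le> s / e + s * p - 1 + ln e - ln s"
    using e s by (simp add: ln_div field_simps)
  moreover have "ln e = s + ln (1 - exp (- s))"
  proof -
    have "e = exp s * (1 - exp (- s))" by (simp add: e_def right_diff_distrib flip: exp_add)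
    then show ?thesis using s by (simp add: ln_mult)
  qed
  moreover have "s * v = s - 1" unfolding v_eq using s by (simp add: field_simps)
  moreover have "s / e + ln (1 - exp (- s)) \<le> ln s / s\<^sup>2"
    unfolding e_def by (rule exponent_bound_ge_2[OF s])
  \<comment> \<open>Since \<open>1 - v = 1 / s\<close>, one has
    \<open>v\<^sup>2 - 2 * v = 1 / s\<^sup>2 - 1\<close> and
    \<open>ln (1 - v) = - ln s\<close>.\<close>
  moreover have "- ((v\<^sup>2 - 2 * v) * ln (1 - v)) = ln s / s\<^sup>2 - ln s"
    unfolding v_eq using s by (simp add: ln_div field_simps power2_eq_square)
  ultimately have *: "- s * v - s * p + ln (1 + p * e) \<le> - ((v\<^sup>2 - 2 * v) * ln (1 - v))"
    by simp
  have "exp (- s * v) * ((1 - p) * exp (- s * p) + p * exp (s * (1 - p)))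
      = exp (- s * (p + v)) * (1 + p * e)"
    unfolding Bernoulli_mgf_eq e_def by (simp add: right_diff_distrib)
  also have "\<dots> = exp (- s * v - s * p + ln (1 + p * e))"
    using pos by (simp add: exp_add exp_diff algebra_simps exp_minus divide_inverse)
  also have "\<dots> \<le> exp (- ((v\<^sup>2 - 2 * v) * ln (1 - v)))" using * by simp
  finally show ?thesis using that[of s] s by simp
qed

section \<open>Sums of independent bounded variables\<close>

context prob_space
begin

text \<open>Convexity bounds the moment generating function by that of the two-point law on
  \<open>{a, b}\<close> with mean \<open>0\<close>, whose weight at \<open>b\<close> is \<open>- a / (b - a)\<close>.\<close>

lemma nn_integral_exp_le_two_point:
  fixes Y :: "'a \<Rightarrow> real"
  assumes Y: "random_variable borel Y" and bnd: "AE \<omega> in M. a \<le> Y \<omega> \<and> Y \<omega> \<le> b"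
    and ab: "a < b" and mean: "expectation Y = 0" and s: "0 \<le> s"
    and p: "p = - a / (b - a)"
  shows "(\<integral>\<^sup>+\<omega>. ennreal (exp (s / (b - a) * Y \<omega>)) \<partial>M)
    \<le> ennreal ((1 - p) * exp (- s * p) + p * exp (s * (1 - p)))"
proof -
  define l where "l = s / (b - a)"
  have l: "0 \<le> l" unfolding l_def using s ab by simp
  \<comment> \<open>The chord of \<open>exp (l * y)\<close> over \<open>[a, b]\<close>. It is
    affine, so its expectation is its value at the mean 0.\<close>
  let ?g = "\<lambda>y. (exp (l * b) - exp (l * a)) / (b - a) * (y - a) + exp (l * a)"
  have int: "integrable M Y"
    using bnd by (intro integrable_const_bound[where B = "max \<bar>a\<bar> \<bar>b\<bar>"] Y) auto
  have le: "AE \<omega> in M. exp (l * Y \<omega>) \<le> ?g (Y \<omega>)"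
    using bnd
  proof eventually_elim
    case (elim \<omega>)
    show ?case
      by (rule convex_onD_Icc'[where f = "\<lambda>x. exp (l * x)"])
         (use elim l in \<open>auto intro: convex_on_exp convex_on_subset\<close>)
  qed
  have "(\<integral>\<^sup>+\<omega>. ennreal (exp (l * Y \<omega>)) \<partial>M) \<le> (\<integral>\<^sup>+\<omega>. ennreal (?g (Y \<omega>)) \<partial>M)"
    using le by (intro nn_integral_mono_AE) (auto intro: ennreal_leI)
  also have "\<dots> = ennreal (\<integral>\<omega>. ?g (Y \<omega>) \<partial>M)"
  proof (rule nn_integral_eq_integral)
    show "integrable M (\<lambda>\<omega>. ?g (Y \<omega>))"
      using int by auto
    show "AE \<omega> in M. 0 \<le> ?g (Y \<omega>)"
      using le by eventually_elim (erule order.trans[rotated], simp)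
  qed
  also have "(\<integral>\<omega>. ?g (Y \<omega>) \<partial>M) = ?g 0"
    using int mean by (simp add: prob_space)
  also have "?g 0 = (1 - p) * exp (l * a) + p * exp (l * b)"
  proof -
    have "?g 0 = (exp (l * b) - exp (l * a)) * p + exp (l * a)" unfolding p by simp
    then show ?thesis by (simp add: algebra_simps)
  qed
  also have "l * a = - s * p"
    using ab unfolding p l_def by simp
  also have "l * b = s * (1 - p)"
    using ab unfolding p l_def by (simp_all add: field_simps)
  finally show ?thesis unfolding l_def .
qed

section \<open>Chernoff bounds for sums of independent, centred, bounded variables\<close>

context
  fixes I :: "'i set" and Y :: "'i \<Rightarrow> 'a \<Rightarrow> real" and a b p :: real
  assumes I: "finite I"
    and indep: "indep_vars (\<lambda>_. borel) Y I"
    and bnd: "\<And>i. i \<in> I \<Longrightarrow> AE \<omega> in M. a \<le> Y i \<omega> \<and> Y i \<omega> \<le> b"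
    and mean: "\<And>i. i \<in> I \<Longrightarrow> expectation (Y i) = 0"
    and ab: "a < b"
  defines "p \<equiv> - a / (b - a)"
begin

lemma random_variable_Y: "i \<in> I \<Longrightarrow> random_variable borel (Y i)"
  using indep by (auto simp: indep_vars_def)

text \<open>Markov's inequality for the exponential of the sum, factorised by independence. The
  number \<open>v\<close> measures the deviation per summand in units of \<open>b - a\<close>, and
  \<open>s\<close> is the exponential parameter in the same units.\<close>

lemma prob_sum_ge_two_point:
  fixes s v :: real
  assumes s: "0 \<le> s"
  shows "prob {\<omega> \<in> space M. (\<Sum>i\<in>I. Y i \<omega>) \<ge> real (card I) * ((b - a) * v)}
    \<le> (exp (- s * v) * ((1 - p) * exp (- s * p) + p * exp (s * (1 - p)))) ^ card I"
proof -
  define l where "l = s / (b - a)"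
  define c where "c = (1 - p) * exp (- s * p) + p * exp (s * (1 - p))"
  have l: "0 \<le> l" unfolding l_def using s ab by simp
  note [measurable] = random_variable_Y
  have mgf: "(\<integral>\<^sup>+\<omega>. ennreal (exp (l * Y i \<omega>)) \<partial>M) \<le> ennreal c" if "i \<in> I" for i
    unfolding l_def c_def using that s ab
    by (intro nn_integral_exp_le_two_point random_variable_Y bnd mean) (auto simp: p_def)
  \<comment> \<open>The formula for \<open>c\<close> does not show its sign without bounds on
    \<open>p\<close>. But \<open>ennreal\<close> sends negative numbers to 0, while
    \<open>ennreal c\<close> dominates the integral of a positive function. For empty
    \<open>I\<close> this argument is void, but then only \<open>c\<close> to the power 0
    occurs.\<close>
  have c: "0 \<le> c" if "I \<noteq> {}"
  proof (rule ccontr)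
    assume "\<not> 0 \<le> c"
    moreover obtain i where i: "i \<in> I" using \<open>I \<noteq> {}\<close> by auto
    ultimately have "(\<integral>\<^sup>+\<omega>. ennreal (exp (l * Y i \<omega>)) \<partial>M) = 0"
      using mgf[OF i] by (simp add: ennreal_neg)
    then have "AE \<omega> in M. ennreal (exp (l * Y i \<omega>)) = 0"
      using i by (subst (asm) nn_integral_0_iff_AE) auto
    then show False by (simp add: AE_False)
  qed
  let ?A = "{\<omega> \<in> space M. (\<Sum>i\<in>I. Y i \<omega>) \<ge> real (card I) * ((b - a) * v)}"
  have "emeasure M ?A
      \<le> (\<integral>\<^sup>+\<omega>. ennreal (exp (- (real (card I) * (s * v)))) * (\<Prod>i\<in>I. ennreal (exp (l * Y i \<omega>))) \<partial>M)"
  proof -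
    have "emeasure M ?A = (\<integral>\<^sup>+\<omega>. indicator ?A \<omega> \<partial>M)"
      by (rule nn_integral_indicator[symmetric]) measurable
    also have "\<dots> \<le> (\<integral>\<^sup>+\<omega>. ennreal (exp (- (real (card I) * (s * v)))) * (\<Prod>i\<in>I. ennreal (exp (l * Y i \<omega>))) \<partial>M)"
    proof (intro nn_integral_mono)
      fix \<omega> assume "\<omega> \<in> space M"
      have eq: "ennreal (exp (- (real (card I) * (s * v)))) * (\<Prod>i\<in>I. ennreal (exp (l * Y i \<omega>)))
        = ennreal (exp (l * (\<Sum>i\<in>I. Y i \<omega>) - real (card I) * (s * v)))"
        using I by (simp add: prod_ennreal exp_sum[symmetric] sum_distrib_left
            exp_diff exp_minus divide_inverse mult.commute flip: ennreal_mult')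
      have "1 \<le> exp (l * (\<Sum>i\<in>I. Y i \<omega>) - real (card I) * (s * v))" if "\<omega> \<in> ?A"
      proof -
        have "l * (real (card I) * ((b - a) * v)) \<le> l * (\<Sum>i\<in>I. Y i \<omega>)"
          using that l by (intro mult_left_mono) auto
        moreover have "l * (real (card I) * ((b - a) * v)) = real (card I) * (s * v)"
          using ab by (simp add: l_def)
        ultimately show ?thesis by simp
      qed
      then show "indicator ?A \<omega> \<le> ennreal (exp (- (real (card I) * (s * v)))) * (\<Prod>i\<in>I. ennreal (exp (l * Y i \<omega>)))"
        unfolding eq by (auto simp: indicator_def simp flip: ennreal_1 intro!: ennreal_leI)
    qed
    finally show ?thesis .
  qed
  also have "\<dots> = ennreal (exp (- (real (card I) * (s * v)))) * (\<integral>\<^sup>+\<omega>. (\<Prod>i\<in>I. ennreal (exp (l * Y i \<omega>))) \<partial>M)"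
    by (rule nn_integral_cmult) measurable
  also have "(\<integral>\<^sup>+\<omega>. (\<Prod>i\<in>I. ennreal (exp (l * Y i \<omega>))) \<partial>M) = (\<Prod>i\<in>I. \<integral>\<^sup>+\<omega>. ennreal (exp (l * Y i \<omega>)) \<partial>M)"
    by (intro indep_vars_nn_integral I indep_vars_compose2[OF indep]) auto
  also have "\<dots> \<le> (\<Prod>i\<in>I. ennreal c)"
    by (intro prod_mono_ennreal mgf)
  also have "ennreal (exp (- (real (card I) * (s * v)))) * (\<Prod>i\<in>I. ennreal c)
      = ennreal ((exp (- s * v) * c) ^ card I)"
  proof (cases "I = {}")
    case False
    then show ?thesis using c
      by (simp add: ennreal_power power_mult_distrib flip: ennreal_mult' exp_of_nat_mult)
  qed simp
  finally have "ennreal (prob ?A) \<le> ennreal ((exp (- s * v) * c) ^ card I)"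
    by (simp add: emeasure_eq_measure mult_left_mono)
  moreover have "0 \<le> (exp (- s * v) * c) ^ card I" using c by (cases "I = {}") auto
  ultimately show ?thesis unfolding c_def by (simp add: ennreal_le_iff)
qed

lemma prob_sum_ge_quartic:
  fixes v :: real
  assumes I_ne: "I \<noteq> {}" and a: "a < 0" and v: "0 \<le> v"
  shows "prob {\<omega> \<in> space M. (\<Sum>i\<in>I. Y i \<omega>) \<ge> real (card I) * ((b - a) * v)}
    \<le> exp (- real (card I) * (2 * v\<^sup>2 + 4 / 9 * v ^ 4))"
proof -
  note [measurable] = random_variable_Y
  have p0: "0 < p" unfolding p_def using a ab by (simp add: divide_less_0_iff)
  let ?P = "\<lambda>v. prob {\<omega> \<in> space M. (\<Sum>i\<in>I. Y i \<omega>) \<ge> real (card I) * ((b - a) * v)}"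
  let ?B = "\<lambda>v. exp (- real (card I) * (2 * v\<^sup>2 + 4 / 9 * v ^ 4))"
  have lt: "?P w \<le> ?B w" if w: "0 \<le> w" "p + w < 1" for w
  proof -
    obtain s where "0 \<le> s" and s: "exp (- s * w) * ((1 - p) * exp (- s * p) + p * exp (s * (1 - p)))
      \<le> exp (- (2 * w\<^sup>2 + 4 / 9 * w ^ 4))"
      by (rule Bernoulli_Chernoff_quartic[OF p0 w])
    have "?P w \<le> (exp (- s * w) * ((1 - p) * exp (- s * p) + p * exp (s * (1 - p)))) ^ card I"
      by (rule prob_sum_ge_two_point[OF \<open>0 \<le> s\<close>])
    also have "\<dots> \<le> exp (- (2 * w\<^sup>2 + 4 / 9 * w ^ 4)) ^ card I"
      using s w p0 by (intro power_mono) auto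
    also have "\<dots> = ?B w" by (simp add: algebra_simps flip: exp_of_nat_mult)
    finally show ?thesis .
  qed
  \<comment> \<open>Here \<open>p + v < 1\<close> means \<open>(b - a) * v < b\<close>, a threshold
    per summand below the largest possible value. At equality the relative entropy degenerates, so
    the bound is obtained as a limit from smaller deviations; beyond it the event is null.\<close>
  consider "v = 0" | "p + v < 1" | "0 < v" "p + v = 1" | "1 < p + v" using v by linarith
  then show ?thesis
  proof cases
    case 1
    then show ?thesis by simp
  next
    case 2
    then show ?thesis using lt v by blast
  next
    case 3
    show ?thesis
    proof (rule tendsto_lowerbound)
      show "(?B \<longlongrightarrow> ?B v) (at_left v)" by (intro tendsto_intros)
      show "\<forall>\<^sub>F w in at_left v. ?P v \<le> ?B w"
        using eventually_at_left_real[OF \<open>0 < v\<close>]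
      proof eventually_elim
        case (elim w)
        have "real (card I) * ((b - a) * w) \<le> real (card I) * ((b - a) * v)"
          using elim ab by (intro mult_left_mono) auto
        then have "?P v \<le> ?P w" by (intro finite_measure_mono) (auto, measurable)
        also have "\<dots> \<le> ?B w" using elim 3 by (intro lt) auto
        finally show ?case .
      qed
    qed simp
  next
    case 4
    have "(b - a) * p = - a" unfolding p_def using ab by simp
    moreover have "(b - a) * 1 < (b - a) * (p + v)" using 4 ab by (intro mult_strict_left_mono) auto
    ultimately have "b < (b - a) * v" by (simp add: distrib_left)
    then have gt: "real (card I) * b < real (card I) * ((b - a) * v)"
      using I I_ne by (simp add: card_gt_0_iff)
    have "AE \<omega> in M. \<forall>i\<in>I. a \<le> Y i \<omega> \<and> Y i \<omega> \<le> b"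
      using I bnd by (intro AE_finite_allI)
    then have "AE \<omega> in M. \<not> (\<Sum>i\<in>I. Y i \<omega>) \<ge> real (card I) * ((b - a) * v)"
    proof eventually_elim
      case (elim \<omega>)
      have "(\<Sum>i\<in>I. Y i \<omega>) \<le> (\<Sum>i\<in>I. b)" using elim by (intro sum_mono) auto
      then show ?case using gt by simp
    qed
    moreover have "{\<omega> \<in> space M. (\<Sum>i\<in>I. Y i \<omega>) \<ge> real (card I) * ((b - a) * v)} \<in> events"
      by measurable
    ultimately have "?P v = 0" by (subst prob_eq_0) auto
    then show ?thesis by simp
  qed
qed

text \<open>For \<open>v \<le> 1/2\<close> the quartic exponent is the larger one. For larger
  \<open>v\<close> both bounds hold separately, and hence the smaller of the two.\<close>

lemma prob_sum_ge_max:
  fixes v :: real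
  assumes I_ne: "I \<noteq> {}" and a: "a < 0" and v: "0 \<le> v" "v < 1"
  shows "prob {\<omega> \<in> space M. (\<Sum>i\<in>I. Y i \<omega>) \<ge> real (card I) * ((b - a) * v)}
    \<le> exp (- real (card I) * max (2 * v\<^sup>2 + 4 / 9 * v ^ 4) ((v\<^sup>2 - 2 * v) * ln (1 - v)))"
    (is "?P \<le> exp (- ?n * max ?f ?g)")
proof (cases "v \<le> 1 / 2")
  case True
  then have "max ?f ?g = ?f" using log_exponent_le_quartic[of v] v by simp
  then show ?thesis using prob_sum_ge_quartic[OF I_ne a v(1)] by simp
next
  case False
  then have v2: "1 / 2 \<le> v" by simp
  have p0: "0 \<le> p" unfolding p_def using a ab by (simp add: divide_le_0_iff)
  obtain s where "0 \<le> s" and s: "exp (- s * v) * ((1 - p) * exp (- s * p) + p * exp (s * (1 - p)))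
      \<le> exp (- ?g)"
    by (rule Bernoulli_Chernoff_log[OF p0 v2 v(2)])
  \<comment> \<open>Only \<open>0 \<le> p\<close> is at hand, so nonnegativity is read off the form
    \<open>1 - p + p * exp s\<close> with \<open>exp s \<ge> 1\<close>.\<close>
  have "0 \<le> exp (- s * v) * ((1 - p) * exp (- s * p) + p * exp (s * (1 - p)))"
  proof -
    have "p * 1 \<le> p * exp s" using p0 \<open>0 \<le> s\<close> by (intro mult_left_mono) auto
    then show ?thesis unfolding Bernoulli_mgf_eq by (intro mult_nonneg_nonneg) auto
  qed
  then have "?P \<le> exp (- ?g) ^ card I"
    using prob_sum_ge_two_point[OF \<open>0 \<le> s\<close>, of v] power_mono[OF s, of "card I"] by linarith
  also have "\<dots> = exp (- ?n * ?g)" by (simp add: algebra_simps flip: exp_of_nat_mult)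
  finally have "?P \<le> exp (- ?n * ?g)" .
  then show ?thesis using prob_sum_ge_quartic[OF I_ne a v(1)] by (simp add: max_def)
qed

end
end

section \<open>Conditioning on the environment and the past\<close>

text \<open>Equality fails at 0 and at \<open>\<top>\<close>, where the product is 0 by convention.
  Such values only decrease the integral of the normalised population.\<close>

lemma ennreal_inverse_mult_le_1: "inverse a * a \<le> (1 :: ennreal)"
  by (cases "a = 0 \<or> a = \<top>") (auto simp: mult.commute less_top simp flip: divide_ennreal_def)

context branching_random_env
begin

abbreviation env :: "'w measure" where
  "env \<equiv> env_algebra M S \<xi>"

lemma measurable_xi: "\<xi> n \<in> M \<rightarrow>\<^sub>M S"
  using env_indep by (auto simp: indep_vars_def)

lemma space_env [simp]: "space env = space M"
  by (simp add: env_algebra_def)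

lemma xi_in_PiM: "(\<lambda>\<omega> n. \<xi> n \<omega>) \<in> M \<rightarrow>\<^sub>M (\<Pi>\<^sub>M n\<in>UNIV. S)"
  by (rule measurable_PiM_single') (auto simp: measurable_xi intro: measurable_space[OF measurable_xi])

lemma subalgebra_env: "subalgebra M env"
proof -
  have "(\<lambda>\<omega> n. \<xi> n \<omega>) \<in> space M \<rightarrow> space (\<Pi>\<^sub>M n\<in>UNIV. S)"
    using xi_in_PiM by (auto dest: measurable_space)
  then show ?thesis
    using measurable_sets[OF xi_in_PiM]
    by (auto simp: subalgebra_def env_algebra_def sets_vimage_algebra2)
qed

lemma measurable_xi_env: "\<xi> n \<in> env \<rightarrow>\<^sub>M S"
proof -
  have "(\<lambda>\<omega> n. \<xi> n \<omega>) \<in> env \<rightarrow>\<^sub>M (\<Pi>\<^sub>M n\<in>UNIV. S)"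
    unfolding env_algebra_def
    by (rule measurable_vimage_algebra1) (use xi_in_PiM in \<open>auto dest: measurable_space\<close>)
  then show ?thesis
    by (rule measurable_compose[OF _ measurable_component_singleton]) simp
qed

sublocale env: finite_measure_subalgebra M env
  by unfold_locales (rule subalgebra_env)

lemma measurable_N: "1 \<le> i \<Longrightarrow> N n i \<in> M \<rightarrow>\<^sub>M count_space UNIV"
  using offspring_cond_indep by (auto simp: cond_indep_vars_def)

lemma measurable_pmf_xi: "(\<lambda>\<omega>. pmf (p (\<xi> n \<omega>)) b) \<in> borel_measurable env"
  by (rule measurable_compose[OF measurable_xi_env law_measurable])

section \<open>Cylinder events of offspring numbers, given the environment\<close>

definition offspring_event :: "(nat \<times> nat) set \<Rightarrow> (nat \<times> nat \<Rightarrow> nat set) \<Rightarrow> 'w set" where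
  "offspring_event J B = {\<omega> \<in> space M. \<forall>j\<in>J. N (fst j) (snd j) \<omega> \<in> B j}"

lemma offspring_event_sets [measurable]:
  assumes "finite J" "J \<subseteq> UNIV \<times> {1..}"
  shows "offspring_event J B \<in> events"
proof -
  have "Measurable.pred M (\<lambda>\<omega>. N (fst j) (snd j) \<omega> \<in> B j)" if "j \<in> J" for j
    using that assms by (intro measurable_compose[OF measurable_N]) auto
  then have "Measurable.pred M (\<lambda>\<omega>. \<forall>j\<in>J. N (fst j) (snd j) \<omega> \<in> B j)"
    using assms by (intro pred_intros_finite) auto
  then show ?thesis
    unfolding offspring_event_def pred_def .
qed

lemma offspring_event_prob_env:
  assumes "finite J" "J \<subseteq> UNIV \<times> {1..}"
  shows "AE \<omega> in M. cond_prob_of M env (offspring_event J B) \<omega>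
    = (\<Prod>j\<in>J. measure_pmf.prob (p (\<xi> (fst j) \<omega>)) (B j))"
proof -
  have "AE \<omega> in M. cond_prob_of M env {\<omega>\<in>space M. \<forall>j\<in>J. (\<lambda>(n, i). N n i) j \<omega> \<in> B j} \<omega>
      = (\<Prod>j\<in>J. cond_prob_of M env {\<omega>\<in>space M. (\<lambda>(n, i). N n i) j \<omega> \<in> B j} \<omega>)"
    using offspring_cond_indep assms by (auto simp: cond_indep_vars_def)
  moreover have "AE \<omega> in M. \<forall>j\<in>J. cond_prob_of M env {\<omega>\<in>space M. (\<lambda>(n, i). N n i) j \<omega> \<in> B j} \<omega>
      = measure_pmf.prob (p (\<xi> (fst j) \<omega>)) (B j)"
    using assms by (intro AE_finite_allI) (auto simp: case_prod_unfold intro!: offspring_cond_law)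
  moreover have "{\<omega>\<in>space M. \<forall>j\<in>J. (\<lambda>(n, i). N n i) j \<omega> \<in> B j} = offspring_event J B"
    by (simp add: offspring_event_def case_prod_unfold)
  ultimately show ?thesis by (auto elim!: eventually_elim2)
qed

text \<open>All generations in \<open>J\<close> lie below \<open>k\<close>, so \<open>(k, i)\<close>
  is a new index, and by conditional independence the conditional probability gains exactly the
  factor \<open>pmf (p (\<xi> k \<omega>)) b\<close>.\<close>

lemma emeasure_offspring_event:
  assumes J: "finite J" "J \<subseteq> {..<k} \<times> {1..}" and i: "1 \<le> i" and C: "C \<in> sets env"
  shows "emeasure M (C \<inter> offspring_event J B \<inter> {\<omega> \<in> space M. N k i \<omega> = b})
    = (\<integral>\<^sup>+\<omega>. ennreal (pmf (p (\<xi> k \<omega>)) b) * indicator (C \<inter> offspring_event J B) \<omega> \<partial>M)"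
proof -
  let ?J = "insert (k, i) J" and ?B = "B((k, i) := {b})"
  let ?E = "offspring_event J B" and ?E' = "offspring_event (insert (k, i) J) (B((k, i) := {b}))"
  let ?q = "\<lambda>\<omega>. pmf (p (\<xi> k \<omega>)) b"
  have notin: "(k, i) \<notin> J" using J by auto
  have J': "J \<subseteq> UNIV \<times> {1..}" "?J \<subseteq> UNIV \<times> {1..}" using J i by auto
  note [measurable] = C offspring_event_sets[OF J(1) J'(1)]
    offspring_event_sets[OF finite.insertI[OF J(1)] J'(2)]
    measurable_pmf_xi
  have CM [measurable]: "C \<in> events" using C subalgebra_env by (auto simp: subalgebra_def)
  have qM [measurable]: "?q \<in> borel_measurable M"
    by (rule measurable_from_subalg[OF subalgebra_env measurable_pmf_xi])
  have E': "?E \<inter> {\<omega> \<in> space M. N k i \<omega> = b} = ?E'"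
    using notin by (auto simp: offspring_event_def)
  have AE_E': "AE \<omega> in M. real_cond_exp M env (indicator ?E') \<omega>
      = ?q \<omega> * real_cond_exp M env (indicator ?E) \<omega>"
    using offspring_event_prob_env[OF finite.insertI[OF J(1)] J'(2), of ?B]
      offspring_event_prob_env[OF J(1) J'(1), of B]
  proof eventually_elim
    case (elim \<omega>)
    have "(\<Prod>j\<in>J. measure_pmf.prob (p (\<xi> (fst j) \<omega>)) (?B j))
        = (\<Prod>j\<in>J. measure_pmf.prob (p (\<xi> (fst j) \<omega>)) (B j))"
      using notin by (intro prod.cong) auto
    then show ?case using elim J notin
      by (simp add: cond_prob_of_def measure_pmf_single)
  qed
  have int: "integrable M (\<lambda>\<omega>. indicator C \<omega> * indicator ?E' \<omega> :: real)"
    "integrable M (\<lambda>\<omega>. (indicator C \<omega> * ?q \<omega>) * indicator ?E \<omega> :: real)"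
    by (rule integrable_const_bound[where B = 1]; auto simp: indicator_def pmf_le_1)+
  have "prob (C \<inter> ?E') = (\<integral>\<omega>. indicator C \<omega> * indicator ?E' \<omega> \<partial>M)"
    by (simp flip: indicator_inter_arith)
  also have "\<dots> = (\<integral>\<omega>. indicator C \<omega> * real_cond_exp M env (indicator ?E') \<omega> \<partial>M)"
    using int(1) by (intro env.real_cond_exp_intg(2)[symmetric]) auto
  also have "\<dots> = (\<integral>\<omega>. (indicator C \<omega> * ?q \<omega>) * real_cond_exp M env (indicator ?E) \<omega> \<partial>M)"
    using AE_E' by (intro integral_cong_AE) auto
  \<comment> \<open>The bracket is measurable with respect to the environment, so the conditional
    expectation next to it can be undone under the integral.\<close>
  also have "\<dots> = (\<integral>\<omega>. (indicator C \<omega> * ?q \<omega>) * indicator ?E \<omega> \<partial>M)"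
    using int(2) by (intro env.real_cond_exp_intg(2)) auto
  finally have "emeasure M (C \<inter> ?E') = ennreal (\<integral>\<omega>. (indicator C \<omega> * ?q \<omega>) * indicator ?E \<omega> \<partial>M)"
    by (simp add: emeasure_eq_measure)
  also have "\<dots> = (\<integral>\<^sup>+\<omega>. ennreal ((indicator C \<omega> * ?q \<omega>) * indicator ?E \<omega>) \<partial>M)"
    using int(2) by (intro nn_integral_eq_integral[symmetric]) auto
  also have "\<dots> = (\<integral>\<^sup>+\<omega>. ennreal (?q \<omega>) * indicator (C \<inter> ?E) \<omega> \<partial>M)"
    by (intro nn_integral_cong) (auto simp: indicator_def)
  finally show ?thesis unfolding E'[symmetric] by (simp add: Int_assoc)
qed

section \<open>The \<open>\<sigma>\<close>-algebra of the environment and the earlier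
  generations\<close>

definition past_generator :: "nat \<Rightarrow> 'w set set" where
  "past_generator k = {C \<inter> offspring_event J B | C J B.
     C \<in> sets env \<and> finite J \<and> J \<subseteq> {..<k} \<times> {1..}}"

lemma past_generatorI:
  "C \<in> sets env \<Longrightarrow> finite J \<Longrightarrow> J \<subseteq> {..<k} \<times> {1..} \<Longrightarrow> C \<inter> offspring_event J B \<in> past_generator k"
  unfolding past_generator_def by blast

text \<open>The whole environment is included, not only its coordinates before \<open>k\<close>.
  Thus weights involving \<open>\<xi> k\<close> are measurable while the offspring numbers of
  generation \<open>k\<close> are being averaged.\<close>

definition past :: "nat \<Rightarrow> 'w measure" where
  "past k = sigma (space M) (past_generator k)"

lemma past_generator_subset_events: "past_generator k \<subseteq> events"
proof
  fix A assume "A \<in> past_generator k"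
  then obtain C J B where A: "A = C \<inter> offspring_event J B" and C: "C \<in> sets env"
    and J: "finite J" "J \<subseteq> {..<k} \<times> {1..}"
    by (auto simp: past_generator_def)
  have "C \<in> events" using C subalgebra_env by (auto simp: subalgebra_def)
  moreover have "offspring_event J B \<in> events"
    using J by (intro offspring_event_sets) auto
  ultimately show "A \<in> events" unfolding A by auto
qed

lemma past_generator_subset_Pow: "past_generator k \<subseteq> Pow (space M)"
  using past_generator_subset_events sets.space_closed by blast

lemma space_past [simp]: "space (past k) = space M"
  by (simp add: past_def space_measure_of[OF past_generator_subset_Pow])

lemma sets_past: "sets (past k) = sigma_sets (space M) (past_generator k)"
  by (simp add: past_def sets_measure_of[OF past_generator_subset_Pow])

lemma subalgebra_past: "subalgebra M (past k)"
  unfolding subalgebra_def sets_past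
  using sets.sigma_sets_subset[OF past_generator_subset_events] by simp

lemma Int_stable_past_generator: "Int_stable (past_generator k)"
proof (rule Int_stableI)
  fix A A' assume "A \<in> past_generator k" "A' \<in> past_generator k"
  then obtain C J B C' J' B'
    where A: "A = C \<inter> offspring_event J B" "C \<in> sets env" "finite J" "J \<subseteq> {..<k} \<times> {1..}"
      and A': "A' = C' \<inter> offspring_event J' B'" "C' \<in> sets env" "finite J'" "J' \<subseteq> {..<k} \<times> {1..}"
    by (auto simp: past_generator_def)
  \<comment> \<open>Outside its index set a family \<open>B\<close> is arbitrary, so it is replaced
    by \<open>UNIV\<close> there before intersecting.\<close>
  let ?B = "\<lambda>j. (if j \<in> J then B j else UNIV) \<inter> (if j \<in> J' then B' j else UNIV)"
  have "A \<inter> A' = (C \<inter> C') \<inter> offspring_event (J \<union> J') ?B"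
  proof -
    have "(\<forall>j\<in>J \<union> J'. N (fst j) (snd j) \<omega> \<in> ?B j)
        \<longleftrightarrow> (\<forall>j\<in>J. N (fst j) (snd j) \<omega> \<in> B j) \<and> (\<forall>j\<in>J'. N (fst j) (snd j) \<omega> \<in> B' j)" for \<omega>
      by (simp only: ball_Un Int_iff) (auto split: if_splits)
    then show ?thesis unfolding A(1) A'(1) offspring_event_def by blast
  qed
  also have "\<dots> \<in> past_generator k"
    using A(2-4) A'(2-4) by (intro past_generatorI sets.Int finite_UnI Un_least)
  finally show "A \<inter> A' \<in> past_generator k" .
qed

lemma sets_env_subset_past: "sets env \<subseteq> sets (past k)"
proof
  fix C assume C: "C \<in> sets env"
  have "C = C \<inter> offspring_event {} (\<lambda>_. UNIV)"
    using sets.sets_into_space[OF C] by (auto simp: offspring_event_def)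
  also have "\<dots> \<in> past_generator k"
    using C by (intro past_generatorI) auto
  finally have "C \<in> past_generator k" .
  then show "C \<in> sets (past k)" unfolding sets_past by blast
qed

lemma measurable_past_if_env: "f \<in> env \<rightarrow>\<^sub>M L \<Longrightarrow> f \<in> past k \<rightarrow>\<^sub>M L"
  by (rule measurable_from_subalg[rotated]) (use sets_env_subset_past in \<open>auto simp: subalgebra_def\<close>)

lemma measurable_N_past:
  assumes "l < k" "1 \<le> i"
  shows "N l i \<in> past k \<rightarrow>\<^sub>M count_space UNIV"
proof (rule measurableI)
  fix A :: "nat set"
  have "N l i -` A \<inter> space (past k) = space M \<inter> offspring_event {(l, i)} (\<lambda>_. A)"
    by (auto simp: offspring_event_def)
  also have "\<dots> \<in> past_generator k"
    using assms sets.top[of env] by (intro past_generatorI) auto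
  finally show "N l i -` A \<inter> space (past k) \<in> sets (past k)"
    unfolding sets_past by blast
qed simp

lemma measurable_population_past: "l \<le> k \<Longrightarrow> population N l \<in> past k \<rightarrow>\<^sub>M count_space UNIV"
proof (induction l)
  case 0
  then show ?case by simp
next
  case (Suc l)
  have "(\<lambda>\<omega>. \<Sum>i = 1..population N l \<omega>. N l i \<omega>) \<in> past k \<rightarrow>\<^sub>M count_space UNIV"
  proof (rule measurable_compose_countable[where f = "\<lambda>z \<omega>. \<Sum>i = 1..z. N l i \<omega>"])
    show "(\<lambda>\<omega>. \<Sum>i = 1..z. N l i \<omega>) \<in> past k \<rightarrow>\<^sub>M count_space UNIV" for z
      by (rule measurable_sum_nat, rule measurable_N_past) (use Suc in auto)
    show "population N l \<in> past k \<rightarrow>\<^sub>M count_space UNIV" using Suc by simp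
  qed
  then show ?case by simp
qed

lemma measurable_population: "population N l \<in> M \<rightarrow>\<^sub>M count_space UNIV"
  by (rule measurable_from_subalg[OF subalgebra_past measurable_population_past[OF order_refl]])

text \<open>In integrated form: given \<open>past k\<close>, the variable \<open>N k i\<close> has
  law \<open>p (\<xi> k)\<close>. The two densities define finite measures that agree on the
  intersection-stable generator, hence on all of \<open>past k\<close>, and so give every
  \<open>past k\<close>-measurable \<open>f\<close> the same integral.\<close>

lemma nn_integral_past_indicator_N:
  assumes f: "f \<in> borel_measurable (past k)" and i: "1 \<le> i"
  shows "(\<integral>\<^sup>+\<omega>. f \<omega> * indicator {b} (N k i \<omega>) \<partial>M) = (\<integral>\<^sup>+\<omega>. f \<omega> * ennreal (pmf (p (\<xi> k \<omega>)) b) \<partial>M)"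
proof -
  let ?g = "\<lambda>\<omega>. indicator {b} (N k i \<omega>) :: ennreal" and ?h = "\<lambda>\<omega>. ennreal (pmf (p (\<xi> k \<omega>)) b)"
  have g [measurable]: "?g \<in> borel_measurable M"
    by (rule measurable_compose[OF measurable_N[OF i]]) simp
  have h [measurable]: "?h \<in> borel_measurable M"
    using measurable_from_subalg[OF subalgebra_env measurable_pmf_xi] by simp
  have fM [measurable]: "f \<in> borel_measurable M"
    by (rule measurable_from_subalg[OF subalgebra_past f])
  have sub: "subalgebra (density M u) (past k)" for u
    using subalgebra_past by (simp add: subalgebra_def)
  have emeas: "emeasure (restr_to_subalg (density M u) (past k)) A = (\<integral>\<^sup>+\<omega>. u \<omega> * indicator A \<omega> \<partial>M)"
    if "u \<in> borel_measurable M" "A \<in> sets (past k)" for u A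
  proof -
    have "A \<in> events" using that(2) subalgebra_past[of k] by (auto simp: subalgebra_def)
    then show ?thesis
      using that by (simp add: emeasure_restr_to_subalg[OF sub] emeasure_density)
  qed
  have "restr_to_subalg (density M ?g) (past k) = restr_to_subalg (density M ?h) (past k)"
  proof (rule measure_eqI_generator_eq[OF Int_stable_past_generator past_generator_subset_Pow,
        where A = "\<lambda>_. space M"])
    fix A assume A: "A \<in> past_generator k"
    then obtain C J B where A_eq: "A = C \<inter> offspring_event J B" and C: "C \<in> sets env"
      and J: "finite J" "J \<subseteq> {..<k} \<times> {1..}"
      by (auto simp: past_generator_def)
    have A_past: "A \<in> sets (past k)" using A unfolding sets_past by blast
    have A_events [measurable]: "A \<in> events" using A past_generator_subset_events by blast
    have "(\<integral>\<^sup>+\<omega>. ?g \<omega> * indicator A \<omega> \<partial>M) = (\<integral>\<^sup>+\<omega>. indicator (A \<inter> {\<omega> \<in> space M. N k i \<omega> = b}) \<omega> \<partial>M)"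
      by (intro nn_integral_cong) (auto simp: indicator_def)
    also have "\<dots> = emeasure M (A \<inter> {\<omega> \<in> space M. N k i \<omega> = b})"
      using measurable_N[OF i] by (intro nn_integral_indicator) measurable
    also have "\<dots> = (\<integral>\<^sup>+\<omega>. ?h \<omega> * indicator A \<omega> \<partial>M)"
      unfolding A_eq by (rule emeasure_offspring_event[OF J i C])
    finally show "emeasure (restr_to_subalg (density M ?g) (past k)) A
        = emeasure (restr_to_subalg (density M ?h) (past k)) A"
      by (simp add: emeas g h A_past)
  next
    have "(\<integral>\<^sup>+\<omega>. ?g \<omega> * indicator (space M) \<omega> \<partial>M) \<le> (\<integral>\<^sup>+\<omega>. 1 \<partial>M)"
      by (intro nn_integral_mono) (auto simp: indicator_def)
    also have "\<dots> < \<infinity>" by (simp add: emeasure_space_1)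
    finally show "emeasure (restr_to_subalg (density M ?g) (past k)) (space M) \<noteq> \<infinity>"
      using sets.top[of "past k"] by (subst emeas[OF g]) auto
  next
    have "space M = space M \<inter> offspring_event {} (\<lambda>_. UNIV)"
      by (auto simp: offspring_event_def)
    also have "\<dots> \<in> past_generator k"
      using sets.top[of env] by (intro past_generatorI) auto
    finally show "range (\<lambda>_::nat. space M) \<subseteq> past_generator k" by auto
  qed (simp_all only: sets_restr_to_subalg[OF sub] sets_past UN_constant UNIV_not_empty if_False)
  then have "integral\<^sup>N (restr_to_subalg (density M ?g) (past k)) f
      = integral\<^sup>N (restr_to_subalg (density M ?h) (past k)) f"
    by (rule arg_cong)
  then show ?thesis
    unfolding nn_integral_subalgebra2[OF sub f] nn_integral_density[OF g fM] nn_integral_density[OF h fM]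
    by (simp only: mult.commute)
qed

text \<open>The mean with values in \<open>[0, \<top>]\<close>. Unlike the Bochner integral in
  \<open>offspring_mean\<close> it is \<open>\<top>\<close> for laws of infinite mean, so it can be
  used in nonnegative integrals before finiteness is invoked.\<close>

definition ennmean :: "'s \<Rightarrow> ennreal" where
  "ennmean s = (\<integral>\<^sup>+b. ennreal (real b) \<partial>measure_pmf (p s))"

lemma ennmean_suminf: "ennmean s = (\<Sum>b. ennreal (real b) * ennreal (pmf (p s) b))"
  unfolding ennmean_def
  by (simp add: nn_integral_measure_pmf nn_integral_count_space_nat mult.commute)

lemma measurable_ennmean [measurable]: "ennmean \<in> borel_measurable S"
proof -
  note [measurable] = law_measurable
  show ?thesis unfolding ennmean_suminf by measurable
qed

lemma nn_integral_past_N: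
  assumes f: "f \<in> borel_measurable (past k)" and i: "1 \<le> i"
  shows "(\<integral>\<^sup>+\<omega>. f \<omega> * ennreal (real (N k i \<omega>)) \<partial>M) = (\<integral>\<^sup>+\<omega>. f \<omega> * ennmean (\<xi> k \<omega>) \<partial>M)"
proof -
  note [measurable] = measurable_N[OF i] measurable_from_subalg[OF subalgebra_past f]
    measurable_from_subalg[OF subalgebra_env measurable_pmf_xi]
  have [measurable]: "(\<lambda>\<omega>. indicator {b} (N k i \<omega>) :: ennreal) \<in> borel_measurable M" for b
    by (rule measurable_compose[OF measurable_N[OF i]]) simp
  have N_eq: "ennreal (real n) = (\<Sum>b. ennreal (real b) * indicator {b} n)" for n
    by (subst suminf_finite[of "{n}"]) auto
  have "(\<integral>\<^sup>+\<omega>. f \<omega> * ennreal (real (N k i \<omega>)) \<partial>M)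
      = (\<integral>\<^sup>+\<omega>. (\<Sum>b. ennreal (real b) * (f \<omega> * indicator {b} (N k i \<omega>))) \<partial>M)"
    by (subst N_eq) (simp add: mult.left_commute flip: ennreal_suminf_cmult)
  also have "\<dots> = (\<Sum>b. ennreal (real b) * (\<integral>\<^sup>+\<omega>. f \<omega> * indicator {b} (N k i \<omega>) \<partial>M))"
    by (simp add: nn_integral_suminf nn_integral_cmult)
  also have "\<dots> = (\<Sum>b. ennreal (real b) * (\<integral>\<^sup>+\<omega>. f \<omega> * ennreal (pmf (p (\<xi> k \<omega>)) b) \<partial>M))"
    by (simp only: nn_integral_past_indicator_N[OF f i])
  also have "\<dots> = (\<integral>\<^sup>+\<omega>. (\<Sum>b. ennreal (real b) * (f \<omega> * ennreal (pmf (p (\<xi> k \<omega>)) b))) \<partial>M)"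
    by (simp add: nn_integral_suminf nn_integral_cmult)
  also have "\<dots> = (\<integral>\<^sup>+\<omega>. f \<omega> * ennmean (\<xi> k \<omega>) \<partial>M)"
    by (simp add: ennmean_suminf mult.left_commute flip: ennreal_suminf_cmult)
  finally show ?thesis .
qed

text \<open>The random number of summands is absorbed into indicators of \<open>i\<close> being at
  most the population size. These are \<open>past k\<close>-measurable, so each individual is
  averaged separately.\<close>

lemma nn_integral_past_population_Suc:
  assumes f: "f \<in> borel_measurable (past k)"
  shows "(\<integral>\<^sup>+\<omega>. f \<omega> * ennreal (real (population N (Suc k) \<omega>)) \<partial>M)
    = (\<integral>\<^sup>+\<omega>. f \<omega> * ennreal (real (population N k \<omega>)) * ennmean (\<xi> k \<omega>) \<partial>M)"
proof -
  \<comment> \<open>Individuals are numbered from 1 and series from 0, hence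
    \<open>Suc i\<close>.\<close>
  let ?u = "\<lambda>i \<omega>. f \<omega> * indicator {..population N k \<omega>} (Suc i)"
  have u: "?u i \<in> borel_measurable (past k)" for i
  proof -
    have "(\<lambda>\<omega>. indicator {..population N k \<omega>} (Suc i) :: ennreal) \<in> borel_measurable (past k)"
      by (rule measurable_compose[OF measurable_population_past]) auto
    then show ?thesis using f by measurable
  qed
  have sum_eq: "(\<Sum>i. indicator {..z} (Suc i) * g i) = (\<Sum>i<z. g i)" for z :: nat and g :: "nat \<Rightarrow> ennreal"
    by (subst suminf_finite[of "{..<z}"]) (auto simp: indicator_def)
  note [measurable] = measurable_from_subalg[OF subalgebra_past u] measurable_N
    measurable_xi
  have "(\<integral>\<^sup>+\<omega>. f \<omega> * ennreal (real (population N (Suc k) \<omega>)) \<partial>M)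
      = (\<integral>\<^sup>+\<omega>. (\<Sum>i. ?u i \<omega> * ennreal (real (N k (Suc i) \<omega>))) \<partial>M)"
  proof (intro nn_integral_cong)
    fix \<omega>
    have "population N (Suc k) \<omega> = (\<Sum>i<population N k \<omega>. N k (Suc i) \<omega>)"
      by (simp add: sum.atLeast1_atMost_eq)
    then show "f \<omega> * ennreal (real (population N (Suc k) \<omega>)) = (\<Sum>i. ?u i \<omega> * ennreal (real (N k (Suc i) \<omega>)))"
      by (simp add: mult.assoc sum_eq del: population.simps)
  qed
  also have "\<dots> = (\<Sum>i. \<integral>\<^sup>+\<omega>. ?u i \<omega> * ennreal (real (N k (Suc i) \<omega>)) \<partial>M)"
    by (intro nn_integral_suminf) measurable
  also have "\<dots> = (\<Sum>i. \<integral>\<^sup>+\<omega>. ?u i \<omega> * ennmean (\<xi> k \<omega>) \<partial>M)"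
    by (simp only: nn_integral_past_N[OF u])
  also have "\<dots> = (\<integral>\<^sup>+\<omega>. (\<Sum>i. ?u i \<omega> * ennmean (\<xi> k \<omega>)) \<partial>M)"
    by (intro nn_integral_suminf[symmetric]) measurable
  also have "\<dots> = (\<integral>\<^sup>+\<omega>. f \<omega> * ennreal (real (population N k \<omega>)) * ennmean (\<xi> k \<omega>) \<partial>M)"
    using sum_eq[of _ "\<lambda>_. 1"] by (simp add: mult.assoc ennreal_of_nat_eq_real_of_nat)
  finally show ?thesis .
qed

text \<open>This is \<open>E W \<le> 1\<close>. The induction averages out the last generation: the
  weight, including the inverse mean of that generation, is measurable with respect to its past, and
  the mean so produced cancels against its inverse up to \<open>\<le>\<close>.\<close>

lemma nn_integral_normalized_population_le_1:
  "(\<integral>\<^sup>+\<omega>. inverse (ennreal (real (population N n\<^sub>0 \<omega>))) * (\<Prod>j<n. inverse (ennmean (\<xi> (n\<^sub>0 + j) \<omega>)))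
      * ennreal (real (population N (n\<^sub>0 + n) \<omega>)) \<partial>M) \<le> 1"
proof (induction n)
  case 0
  have "(\<integral>\<^sup>+\<omega>. inverse (ennreal (real (population N n\<^sub>0 \<omega>))) * ennreal (real (population N n\<^sub>0 \<omega>)) \<partial>M)
      \<le> (\<integral>\<^sup>+\<omega>. 1 \<partial>M)"
    by (intro nn_integral_mono ennreal_inverse_mult_le_1)
  then show ?case by (simp add: emeasure_space_1)
next
  case (Suc n)
  let ?k = "n\<^sub>0 + n"
  let ?f = "\<lambda>n \<omega>. inverse (ennreal (real (population N n\<^sub>0 \<omega>))) * (\<Prod>j<n. inverse (ennmean (\<xi> (n\<^sub>0 + j) \<omega>)))"
  have f: "?f (Suc n) \<in> borel_measurable (past ?k)"
  proof -
    have [measurable]: "population N n\<^sub>0 \<in> past ?k \<rightarrow>\<^sub>M count_space UNIV"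
      by (rule measurable_population_past) simp
    have [measurable]: "\<xi> l \<in> past ?k \<rightarrow>\<^sub>M S" for l
      by (rule measurable_past_if_env[OF measurable_xi_env])
    show ?thesis by measurable
  qed
  have "(\<integral>\<^sup>+\<omega>. ?f (Suc n) \<omega> * ennreal (real (population N (Suc ?k) \<omega>)) \<partial>M)
      = (\<integral>\<^sup>+\<omega>. ?f (Suc n) \<omega> * ennreal (real (population N ?k \<omega>)) * ennmean (\<xi> ?k \<omega>) \<partial>M)"
    by (rule nn_integral_past_population_Suc[OF f])
  also have "\<dots> \<le> (\<integral>\<^sup>+\<omega>. ?f n \<omega> * ennreal (real (population N ?k \<omega>)) \<partial>M)"
  proof (intro nn_integral_mono)
    fix \<omega>
    have "?f (Suc n) \<omega> * ennreal (real (population N ?k \<omega>)) * ennmean (\<xi> ?k \<omega>)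
        = ?f n \<omega> * ennreal (real (population N ?k \<omega>)) * (inverse (ennmean (\<xi> ?k \<omega>)) * ennmean (\<xi> ?k \<omega>))"
      by (simp add: ac_simps)
    also have "\<dots> \<le> ?f n \<omega> * ennreal (real (population N ?k \<omega>)) * 1"
      by (intro mult_left_mono ennreal_inverse_mult_le_1) auto
    finally show "?f (Suc n) \<omega> * ennreal (real (population N ?k \<omega>)) * ennmean (\<xi> ?k \<omega>)
        \<le> ?f n \<omega> * ennreal (real (population N ?k \<omega>))" by simp
  qed
  also have "\<dots> \<le> 1" by (rule Suc)
  finally show ?case by (simp only: add_Suc_right)
qed

section \<open>Transfer from generation 0 to every generation, and survival\<close>

lemma AE_xi_transfer:
  assumes "Measurable.pred S P" "AE \<omega> in M. P (\<xi> 0 \<omega>)"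
  shows "AE \<omega> in M. P (\<xi> n \<omega>)"
proof -
  have P: "{s \<in> space S. P s} \<in> sets S" using assms(1) by (simp add: pred_def)
  have "AE s in distr M S (\<xi> 0). P s"
    using AE_distr_iff[OF measurable_xi P] assms(2) by simp
  then have "AE s in distr M S (\<xi> n). P s"
    by (simp only: env_identically_distributed[of n])
  then show ?thesis using AE_distr_iff[OF measurable_xi P] by simp
qed

lemma expectation_xi_transfer:
  fixes f :: "'s \<Rightarrow> real"
  assumes "f \<in> borel_measurable S"
  shows "expectation (\<lambda>\<omega>. f (\<xi> n \<omega>)) = expectation (\<lambda>\<omega>. f (\<xi> 0 \<omega>))"
  using integral_distr[OF measurable_xi assms, of n] integral_distr[OF measurable_xi assms, of 0]
  by (simp only: env_identically_distributed[of n])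

text \<open>The logarithmic mean as a function of the environment value, so that it can be evaluated
  at every \<open>\<xi> k\<close>. As \<open>enn2real\<close> maps \<open>\<top>\<close> to 0, it
  agrees with \<open>log_mean\<close> also for infinite means.\<close>

definition lnmean :: "'s \<Rightarrow> real" where
  "lnmean s = ln (enn2real (ennmean s))"

lemma measurable_lnmean [measurable]: "lnmean \<in> borel_measurable S"
  unfolding lnmean_def[abs_def] by measurable

lemma offspring_mean_eq: "offspring_mean p \<xi> n \<omega> = enn2real (ennmean (\<xi> n \<omega>))"
  unfolding offspring_mean_def ennmean_def by (intro integral_eq_nn_integral) auto

lemma log_mean_eq: "log_mean p \<xi> \<omega> = lnmean (\<xi> 0 \<omega>)"
  by (simp add: log_mean_def lnmean_def offspring_mean_eq)

lemma ennmean_less_top: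
  "finite_offspring_mean p \<xi> n \<omega> \<Longrightarrow> ennmean (\<xi> n \<omega>) < \<top>"
  by (simp add: finite_offspring_mean_def ennmean_def integrable_iff_bounded)

lemma ennmean_ge_1:
  assumes "pmf (p s) 0 = 0"
  shows "1 \<le> ennmean s"
proof -
  have "1 = (\<integral>\<^sup>+b. 1 \<partial>measure_pmf (p s))" by (simp add: measure_pmf.emeasure_space_1)
  also have "\<dots> \<le> ennmean s"
    unfolding ennmean_def
  proof (intro nn_integral_mono_AE, unfold AE_measure_pmf_iff, intro ballI)
    fix b assume "b \<in> set_pmf (p s)"
    then have "b \<noteq> 0" using assms by (metis set_pmf_iff)
    then show "1 \<le> ennreal (real b)" by simp
  qed
  finally show ?thesis .
qed

text \<open>With constant weight 1 the conditional law gives each \<open>N k i\<close> the value 0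
  with probability 0. Outside a countable union of null sets the first individual of each generation
  then has a child.\<close>

lemma AE_population_ge_1:
  assumes "AE \<omega> in M. pmf (p (\<xi> 0 \<omega>)) 0 = 0"
  shows "AE \<omega> in M. \<forall>n. 1 \<le> population N n \<omega>"
proof -
  have "AE \<omega> in M. N k (Suc i) \<omega> \<noteq> 0" for k i
  proof -
    have [measurable]: "(\<lambda>\<omega>. indicator {0} (N k (Suc i) \<omega>) :: ennreal) \<in> borel_measurable M"
      by (rule measurable_compose[OF measurable_N]) auto
    have "AE \<omega> in M. pmf (p (\<xi> k \<omega>)) 0 = 0"
      using law_measurable by (intro AE_xi_transfer[OF _ assms]) measurable
    then have "(\<integral>\<^sup>+\<omega>. 1 * ennreal (pmf (p (\<xi> k \<omega>)) 0) \<partial>M) = (\<integral>\<^sup>+\<omega>. 0 \<partial>M)"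
      by (intro nn_integral_cong_AE) auto
    then have "(\<integral>\<^sup>+\<omega>. 1 * indicator {0} (N k (Suc i) \<omega>) \<partial>M) = 0"
      by (subst nn_integral_past_indicator_N) auto
    then have "AE \<omega> in M. indicator {0} (N k (Suc i) \<omega>) = (0 :: ennreal)"
      by (subst (asm) nn_integral_0_iff_AE) auto
    then show ?thesis by (auto simp: indicator_def elim!: eventually_mono)
  qed
  then have "AE \<omega> in M. \<forall>k i. N k (Suc i) \<omega> \<noteq> 0" by (simp add: AE_all_countable)
  then show ?thesis
  proof eventually_elim
    case (elim \<omega>)
    show ?case
    proof
      fix n show "1 \<le> population N n \<omega>"
      proof (induction n)
        case (Suc n)
        have "1 \<le> N n (Suc 0) \<omega>" using elim by (simp add: Suc_le_eq)
        also have "\<dots> \<le> (\<Sum>i = 1..population N n \<omega>. N n i \<omega>)"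
          using Suc by (intro member_le_sum) auto
        finally show ?case by simp
      qed simp
    qed
  qed
qed

text \<open>Markov's inequality for \<open>W\<close>. For \<open>c = exp (- n * x / 2)\<close> and
  positive finite quantities the event says \<open>ln W \<ge> n * x / 2\<close>.\<close>

lemma prob_normalized_population_ge:
  assumes "0 \<le> c"
  shows "prob {\<omega> \<in> space M. 1 \<le> ennreal c * (inverse (ennreal (real (population N n\<^sub>0 \<omega>)))
      * (\<Prod>j<n. inverse (ennmean (\<xi> (n\<^sub>0 + j) \<omega>))) * ennreal (real (population N (n\<^sub>0 + n) \<omega>)))} \<le> c"
  (is "prob {\<omega> \<in> space M. 1 \<le> ennreal c * ?u \<omega>} \<le> c")
proof -
  note [measurable] = measurable_population measurable_xi
  have "emeasure M ({\<omega> \<in> space M. 1 \<le> ennreal c * ?u \<omega>})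
      \<le> ennreal c * (\<integral>\<^sup>+\<omega>. ?u \<omega> * indicator (space M) \<omega> \<partial>M)"
    by (rule nn_integral_Markov_inequality) measurable
  also have "(\<integral>\<^sup>+\<omega>. ?u \<omega> * indicator (space M) \<omega> \<partial>M) = (\<integral>\<^sup>+\<omega>. ?u \<omega> \<partial>M)"
    by (intro nn_integral_cong) simp
  also have "ennreal c * \<dots> \<le> ennreal c * 1"
    by (intro mult_left_mono nn_integral_normalized_population_le_1) simp
  finally show ?thesis using assms by (simp add: emeasure_eq_measure)
qed

text \<open>The pointwise splitting: if the logarithmic growth reaches
  \<open>n * (x + \<mu>)\<close> and the centred environment sum stays below
  \<open>n * x / 2\<close>, then \<open>ln W\<close> supplies the other
  \<open>n * x / 2\<close>.\<close>

lemma normalized_population_ge_if: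
  fixes \<mu> :: real
  assumes Z: "\<And>k. 1 \<le> population N k \<omega>"
    and m: "\<And>k. 1 \<le> ennmean (\<xi> k \<omega>)" "\<And>k. ennmean (\<xi> k \<omega>) < \<top>"
    and ge: "real n * (x + \<mu>) \<le> ln (real (population N (n\<^sub>0 + n) \<omega>) / real (population N n\<^sub>0 \<omega>))"
    and lt: "(\<Sum>j<n. lnmean (\<xi> (n\<^sub>0 + j) \<omega>) - \<mu>) < real n * x / 2"
  shows "1 \<le> ennreal (exp (- (1 / 2) * real n * x)) * (inverse (ennreal (real (population N n\<^sub>0 \<omega>)))
      * (\<Prod>j<n. inverse (ennmean (\<xi> (n\<^sub>0 + j) \<omega>))) * ennreal (real (population N (n\<^sub>0 + n) \<omega>)))"
proof -
  define z0 z where "z0 = real (population N n\<^sub>0 \<omega>)" and "z = real (population N (n\<^sub>0 + n) \<omega>)"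
  define r where "r j = enn2real (ennmean (\<xi> (n\<^sub>0 + j) \<omega>))" for j
  have z: "0 < z0" "0 < z" using Z[of n\<^sub>0] Z[of "n\<^sub>0 + n"] by (auto simp: z0_def z_def)
  have r_eq: "ennmean (\<xi> (n\<^sub>0 + j) \<omega>) = ennreal (r j)" for j
    unfolding r_def using m(2)[of "n\<^sub>0 + j"] by simp
  have r: "0 < r j" for j
    using m(1)[of "n\<^sub>0 + j"] unfolding r_eq by (simp add: ennreal_le_iff2 flip: ennreal_1)
  have prod_r: "0 < (\<Prod>j<n. r j)" using r by (intro prod_pos) auto
  have "ln (\<Prod>j<n. r j) = (\<Sum>j<n. ln (r j))" using r by (intro ln_prod) (auto simp: less_imp_neq[symmetric])
  then have "ln (z / z0 / (\<Prod>j<n. r j)) = ln (z / z0) - (\<Sum>j<n. ln (r j))"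
    using z prod_r ln_divide_pos[of "z / z0" "\<Prod>j<n. r j"] by simp
  moreover have "(\<Sum>j<n. lnmean (\<xi> (n\<^sub>0 + j) \<omega>) - \<mu>) = (\<Sum>j<n. ln (r j)) - real n * \<mu>"
    by (simp add: sum_subtractf lnmean_def r_def)
  ultimately have le: "real n * x / 2 \<le> ln (z / z0 / (\<Prod>j<n. r j))"
    using ge lt unfolding z0_def[symmetric] z_def[symmetric] by (simp add: distrib_left)
  have "0 < z / z0 / (\<Prod>j<n. r j)" using z prod_r by simp
  then have "exp (real n * x / 2) \<le> z / z0 / (\<Prod>j<n. r j)"
    using le by (simp only: ln_ge_iff)
  then have "exp (- (1 / 2) * real n * x) * exp (real n * x / 2)
      \<le> exp (- (1 / 2) * real n * x) * (z / z0 / (\<Prod>j<n. r j))"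
    by (rule mult_left_mono) simp
  moreover have "exp (- (1 / 2) * real n * x) * exp (real n * x / 2) = 1"
    by (simp flip: exp_add)
  moreover have "z / z0 / (\<Prod>j<n. r j) = inverse z0 * inverse (\<Prod>j<n. r j) * z"
    by (simp only: divide_inverse mult_ac)
  ultimately have "ennreal 1 \<le> ennreal (exp (- (1 / 2) * real n * x) * (inverse z0 * inverse (\<Prod>j<n. r j) * z))"
    by (intro ennreal_leI) (simp only:)
  also have "\<dots> = ennreal (exp (- (1 / 2) * real n * x))
      * (ennreal (inverse z0) * ennreal (inverse (\<Prod>j<n. r j)) * ennreal z)"
    using z prod_r by (simp only: ennreal_mult' ennreal_mult'' exp_ge_zero inverse_nonnegative_iff_nonnegative less_imp_le)
  also have "ennreal (inverse (\<Prod>j<n. r j)) = (\<Prod>j<n. inverse (ennreal (r j)))"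
  proof -
    have "ennreal (inverse (\<Prod>j<n. r j)) = ennreal (\<Prod>j<n. inverse (r j))"
      using prod_inversef[of r "{..<n}"] by (simp add: comp_def)
    also have "\<dots> = (\<Prod>j<n. ennreal (inverse (r j)))"
      using r by (intro prod_ennreal[symmetric]) (simp add: less_imp_le)
    finally show ?thesis using r by (simp add: inverse_ennreal)
  qed
  also have "ennreal (inverse z0) = inverse (ennreal z0)"
    using z by (simp add: inverse_ennreal)
  finally show ?thesis unfolding r_eq z0_def z_def by simp
qed

end

section \<open>Combination of the environment bound and the bound for the normalised
  population\<close>

theorem theorem2p6:
  fixes M :: "'w measure" and S :: "'s measure"
    and p :: "'s \<Rightarrow> nat pmf"
    and \<xi> :: "nat \<Rightarrow> 'w \<Rightarrow> 's"
    and N :: "nat \<Rightarrow> nat \<Rightarrow> 'w \<Rightarrow> nat"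
    and H\<^sub>1 H\<^sub>2 x :: real and n\<^sub>0 n :: nat
  assumes "branching_random_env M S p \<xi> N"
    and "AE \<omega> in M. pmf (p (\<xi> 0 \<omega>)) 0 = 0"
    and "AE \<omega> in M. finite_offspring_mean p \<xi> 0 \<omega>"
    and "integrable M (log_mean p \<xi>)"
    and "integrable M (\<lambda>\<omega>. (log_mean p \<xi> \<omega> - drift M p \<xi>)\<^sup>2)"
    and "0 < env_variance M p \<xi>"
    and "H\<^sub>1 < H\<^sub>2"
    and "AE \<omega> in M. H\<^sub>1 \<le> log_mean p \<xi> \<omega> - drift M p \<xi> \<and> log_mean p \<xi> \<omega> - drift M p \<xi> \<le> H\<^sub>2"
    and "1 \<le> n"
    and "x \<in> {0..<2 * (H\<^sub>2 - H\<^sub>1)}"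
  shows "\<P>(\<omega> in M. 1 / real n * ln (real (population N (n\<^sub>0 + n) \<omega>) / real (population N n\<^sub>0 \<omega>))
              - drift M p \<xi> \<ge> x)
           \<le> exp (- real n * max (psi1 H\<^sub>1 H\<^sub>2 x) (psi2 H\<^sub>1 H\<^sub>2 x)) + exp (- (1/2) * real n * x)
       \<and> exp (- real n * max (psi1 H\<^sub>1 H\<^sub>2 x) (psi2 H\<^sub>1 H\<^sub>2 x)) + exp (- (1/2) * real n * x)
           \<le> (1 - x / (2 * (H\<^sub>2 - H\<^sub>1)))
                powr (real n * x / (H\<^sub>2 - H\<^sub>1) * (1 - x / (4 * (H\<^sub>2 - H\<^sub>1))))
              + exp (- (1/2) * real n * x)"
proof -
  interpret branching_random_env M S p \<xi> N by fact
  define \<mu> where "\<mu> = drift M p \<xi>"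
  define v where "v = x / (2 * (H\<^sub>2 - H\<^sub>1))"
  define Y where "Y k \<omega> = lnmean (\<xi> k \<omega>) - \<mu>" for k \<omega>
  note H = \<open>H\<^sub>1 < H\<^sub>2\<close> and n = \<open>1 \<le> n\<close>
  have v: "0 \<le> v" "v < 1" and x_eq: "x = 2 * (H\<^sub>2 - H\<^sub>1) * v"
    using assms(10) H by (auto simp: v_def)
  have \<mu>_eq: "\<mu> = expectation (\<lambda>\<omega>. lnmean (\<xi> 0 \<omega>))"
    by (simp add: \<mu>_def drift_def log_mean_eq[abs_def])
  have int0: "integrable M (\<lambda>\<omega>. lnmean (\<xi> 0 \<omega>))"
    using assms(4) by (simp add: log_mean_eq[abs_def])
  have bnd0: "AE \<omega> in M. H\<^sub>1 \<le> lnmean (\<xi> 0 \<omega>) - \<mu> \<and> lnmean (\<xi> 0 \<omega>) - \<mu> \<le> H\<^sub>2"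
    using assms(8) by (simp add: log_mean_eq \<mu>_def)
  \<comment> \<open>Otherwise the centred variable would be nonnegative with mean 0, hence almost
    surely 0, against the positive variance. This makes the weight \<open>p\<close> of the two-point
    law positive.\<close>
  have H1: "H\<^sub>1 < 0"
  proof (rule ccontr)
    assume "\<not> H\<^sub>1 < 0"
    then have nonneg: "AE \<omega> in M. 0 \<le> lnmean (\<xi> 0 \<omega>) - \<mu>"
      using bnd0 by (auto elim!: eventually_mono)
    have "expectation (\<lambda>\<omega>. lnmean (\<xi> 0 \<omega>) - \<mu>) = 0"
      using int0 by (simp add: \<mu>_eq prob_space)
    then have "AE \<omega> in M. lnmean (\<xi> 0 \<omega>) - \<mu> = 0"
      using int0 nonneg by (subst (asm) integral_nonneg_eq_0_iff_AE) auto
    then have "env_variance M p \<xi> = (\<integral>\<omega>. 0 \<partial>M)"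
      unfolding env_variance_def log_mean_eq \<mu>_def[symmetric]
      using borel_measurable_integrable[OF int0] by (intro integral_cong_AE) auto
    then show False using assms(6) by simp
  qed
  have max_eq: "max (psi1 H\<^sub>1 H\<^sub>2 x) (psi2 H\<^sub>1 H\<^sub>2 x)
      = max (2 * v\<^sup>2 + 4 / 9 * v ^ 4) ((v\<^sup>2 - 2 * v) * ln (1 - v))"
  proof -
    define h where "h = H\<^sub>2 - H\<^sub>1"
    have h: "0 < h" "x = 2 * h * v" using H by (auto simp: h_def x_eq)
    have "psi1 H\<^sub>1 H\<^sub>2 x = 2 * v\<^sup>2 + 4 / 9 * v ^ 4"
      using h(1) unfolding psi1_def h_def[symmetric] h(2) by (simp add: power_mult_distrib)
    moreover have "psi2 H\<^sub>1 H\<^sub>2 x = (v\<^sup>2 - 2 * v) * ln (1 - v)"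
      using h(1) unfolding psi2_def h_def[symmetric] h(2) by (simp add: power_mult_distrib)
    ultimately show ?thesis by simp
  qed
  have Y_ge: "prob {\<omega> \<in> space M. (\<Sum>j<n. Y (n\<^sub>0 + j) \<omega>) \<ge> real n * x / 2}
      \<le> exp (- real n * max (psi1 H\<^sub>1 H\<^sub>2 x) (psi2 H\<^sub>1 H\<^sub>2 x))"
  proof -
    let ?I = "{n\<^sub>0..<n\<^sub>0 + n}"
    have "prob {\<omega> \<in> space M. (\<Sum>k\<in>?I. Y k \<omega>) \<ge> real (card ?I) * ((H\<^sub>2 - H\<^sub>1) * v)}
        \<le> exp (- real (card ?I) * max (2 * v\<^sup>2 + 4 / 9 * v ^ 4) ((v\<^sup>2 - 2 * v) * ln (1 - v)))"
    proof (rule prob_sum_ge_max)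
      show "indep_vars (\<lambda>_. borel) Y ?I"
        unfolding Y_def[abs_def]
        by (rule indep_vars_compose2[OF indep_vars_subset[OF env_indep]]) auto
      show "AE \<omega> in M. H\<^sub>1 \<le> Y k \<omega> \<and> Y k \<omega> \<le> H\<^sub>2" for k
        unfolding Y_def by (rule AE_xi_transfer[OF _ bnd0]) measurable
      show "expectation (Y k) = 0" for k
      proof -
        have "expectation (Y k) = expectation (\<lambda>\<omega>. lnmean (\<xi> 0 \<omega>) - \<mu>)"
          unfolding Y_def[abs_def] by (rule expectation_xi_transfer) measurable
        also have "\<dots> = 0" using int0 by (simp add: \<mu>_eq prob_space)
        finally show ?thesis .
      qed
    qed (use n v H H1 in auto)
    moreover have "real (card ?I) * ((H\<^sub>2 - H\<^sub>1) * v) = real n * x / 2"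
      by (simp add: x_eq)
    moreover have "(\<Sum>k\<in>?I. Y k \<omega>) = (\<Sum>j<n. Y (n\<^sub>0 + j) \<omega>)" for \<omega>
      by (simp add: sum.atLeastLessThan_shift_0[of _ n\<^sub>0] lessThan_atLeast0)
    moreover have "- real (card ?I) = - real n" by simp
    ultimately show ?thesis unfolding max_eq by (simp only:)
  qed
  let ?A = "{\<omega> \<in> space M. 1 / real n * ln (real (population N (n\<^sub>0 + n) \<omega>) / real (population N n\<^sub>0 \<omega>)) - drift M p \<xi> \<ge> x}"
  let ?A1 = "{\<omega> \<in> space M. (\<Sum>j<n. Y (n\<^sub>0 + j) \<omega>) \<ge> real n * x / 2}"
  let ?A2 = "{\<omega> \<in> space M. 1 \<le> ennreal (exp (- (1 / 2) * real n * x)) * (inverse (ennreal (real (population N n\<^sub>0 \<omega>)))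
      * (\<Prod>j<n. inverse (ennmean (\<xi> (n\<^sub>0 + j) \<omega>))) * ennreal (real (population N (n\<^sub>0 + n) \<omega>)))}"
  note [measurable] = measurable_population measurable_xi
  have A1: "?A1 \<in> events"
  proof -
    have [measurable]: "Y k \<in> borel_measurable M" for k
      unfolding Y_def[abs_def] by measurable
    show ?thesis by measurable
  qed
  have A2: "?A2 \<in> events" by measurable
  have "AE \<omega> in M. \<forall>k. 1 \<le> ennmean (\<xi> k \<omega>) \<and> ennmean (\<xi> k \<omega>) < \<top>"
  proof (unfold AE_all_countable, intro allI)
    fix k
    have "AE \<omega> in M. 1 \<le> ennmean (\<xi> 0 \<omega>) \<and> ennmean (\<xi> 0 \<omega>) < \<top>"
      using assms(2,3) by eventually_elim (simp add: ennmean_ge_1 ennmean_less_top)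
    then show "AE \<omega> in M. 1 \<le> ennmean (\<xi> k \<omega>) \<and> ennmean (\<xi> k \<omega>) < \<top>"
      by (rule AE_xi_transfer[rotated]) measurable
  qed
  \<comment> \<open>The deviation \<open>n * x\<close> is shared equally: \<open>?A1\<close> is a
    large environment sum, \<open>?A2\<close> a large normalised population.\<close>
  then have "AE \<omega> in M. \<omega> \<in> ?A \<longrightarrow> \<omega> \<in> ?A1 \<union> ?A2"
    using AE_population_ge_1[OF assms(2)]
  proof eventually_elim
    case (elim \<omega>)
    show ?case
    proof
      assume A: "\<omega> \<in> ?A"
      then have ge: "real n * (x + \<mu>) \<le> ln (real (population N (n\<^sub>0 + n) \<omega>) / real (population N n\<^sub>0 \<omega>))"
        using n by (simp add: \<mu>_def field_simps)
      show "\<omega> \<in> ?A1 \<union> ?A2"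
      proof (cases "\<omega> \<in> ?A1")
        case False
        then have "(\<Sum>j<n. lnmean (\<xi> (n\<^sub>0 + j) \<omega>) - \<mu>) < real n * x / 2"
          using A by (simp add: Y_def)
        then have "\<omega> \<in> ?A2"
          using A elim by (intro CollectI conjI normalized_population_ge_if[OF _ _ _ ge]) auto
        then show ?thesis ..
      qed simp
    qed
  qed
  then have "prob ?A \<le> prob (?A1 \<union> ?A2)"
    by (rule finite_measure_mono_AE[OF _ sets.Un[OF A1 A2]])
  also have "\<dots> \<le> prob ?A1 + prob ?A2" by (rule measure_Un_le[OF A1 A2])
  also have "\<dots> \<le> exp (- real n * max (psi1 H\<^sub>1 H\<^sub>2 x) (psi2 H\<^sub>1 H\<^sub>2 x)) + exp (- (1 / 2) * real n * x)"
    by (intro add_mono Y_ge prob_normalized_population_ge) simp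
  finally have "prob ?A \<le> \<dots>" .
  moreover have "exp (- real n * max (psi1 H\<^sub>1 H\<^sub>2 x) (psi2 H\<^sub>1 H\<^sub>2 x))
      \<le> (1 - x / (2 * (H\<^sub>2 - H\<^sub>1))) powr (real n * x / (H\<^sub>2 - H\<^sub>1) * (1 - x / (4 * (H\<^sub>2 - H\<^sub>1))))"
  proof -
    \<comment> \<open>With this exponent the power of \<open>1 - v\<close> is exactly the
      exponential of \<open>- n\<close> times the second exponent, so the second inequality only
      bounds the maximum below by that entry.\<close>
    have "real n * x / (H\<^sub>2 - H\<^sub>1) * (1 - x / (4 * (H\<^sub>2 - H\<^sub>1))) = - real n * (v\<^sup>2 - 2 * v)"
    proof -
      define h where "h = H\<^sub>2 - H\<^sub>1"
      have h: "0 < h" and x: "x = 2 * h * v" using H by (auto simp: h_def x_eq)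
      have "x / h = 2 * v" "x / (4 * h) = v / 2" unfolding x using h by simp_all
      then have "real n * x / h * (1 - x / (4 * h)) = real n * (2 * v) * (1 - v / 2)"
        by (metis times_divide_eq_right)
      then show ?thesis
        unfolding h_def[symmetric] by (simp add: algebra_simps power2_eq_square)
    qed
    moreover have "real n * ((v\<^sup>2 - 2 * v) * ln (1 - v)) \<le> real n * max (psi1 H\<^sub>1 H\<^sub>2 x) (psi2 H\<^sub>1 H\<^sub>2 x)"
      unfolding max_eq by (intro mult_left_mono) auto
    ultimately show ?thesis
      using v unfolding v_def[symmetric] powr_def by (simp add: mult.assoc)
  qed
  ultimately show ?thesis by (intro conjI add_right_mono)
qed

end
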